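(* Let $(X_k)_{k\ge 0}$ be a sequence of independent real-valued random variables on a probability space $(\Omega,\mathcal A,\mathbb P)$ and let $(a_k)_{k\ge 0}$ be a sequence of complex numbers such that, for every compact set $K\subset\mathbb R$ not containing $0$, $$\forall \varepsilon>0,\ \exists N>0,\quad \sup_{m>n\ge N}\ \sup_{\alpha\in K}\ \sup_{j\in\mathbb Z\setminus\{0\}}\left|\sum_{k=n}^m a_k\varphi_{X_k}(j\alpha)\right|<\varepsilon .$$ Assume moreover that one of the following two cases holds: Case 1 (polynomial): there exist $\beta>0$ and $d>0$ with $\mathbb E|X_k|^\beta=\mathcal O(k^d)$, and $$\sum_{n\ge 2}\frac{\sqrt{\sum_{k\ge n}|a_k|^2}}{n\sqrt{\log n}}<+\infty;$$ Case 2 (subexponential): there exist $\beta>0$ and $\gamma\in(0,1)$ with $\mathbb E|X_k|^\beta=\mathcal O(2^{k^\gamma})$, and $$\sum_{n\ge 1}\frac{\sqrt{\sum_{k\ge n}|a_k|^2}}{n^{1-\gamma/2}}<+\infty .$$ Then, in both cases, there exists a measurable set $\Omega_0$ with $\mathbb P(\Omega_0)=1$ such that for all $\omega\in\Omega_0$ and all $f\in B(\mathbb T)$ with $\int_{\mathbb T}f(t)\,dt=0$: for every $\alpha\in\mathbb R\setminus\{0\}$ the series $$F(\alpha,\omega)=\sum_{k=0}^\infty a_k f(\alpha X_k(\omega))$$ is well defined, the function $\alpha\mapsto F(\alpha,\omega)$ is continuous on $\mathbb R\setminus\{0\}$, and the series defining $F$ converges uniformly in $\alpha$ on every compact subset of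 $\mathbb R$ not containing $0$.
   Context: $\mathbb T=\mathbb R/\mathbb Z$, and functions on $\mathbb T$ are identified with $1$-periodic functions on $\mathbb R$. $B(\mathbb T)$ is the set of functions $f:\mathbb T\to\mathbb C$ of the form $f(\alpha)=\sum_{j\in\mathbb Z}\hat f(j)\exp(2i\pi\alpha j)$ with $$|||f|||:=\sum_{j\in\mathbb Z}|\hat f(j)|\sqrt{\log(|j|+3)}<+\infty .$$ For a real random variable $X$, $\varphi_X(t)=\mathbb E(e^{2i\pi tX})$ for $t\in\mathbb R$. The symbol $\mathcal O$ is understood as $k\to\infty$. The set $\Omega_0$ does not depend on $f$. *)

theory Defs
  imports "HOL-Probability.Probability" "HOL-Library.Landau_Symbols"
begin

text \<open>
  Functions on the torus are represented by 1-periodic functions on the reals, and integrals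
  over the torus by integrals over the unit interval.
\<close>

definition fourier_coeff :: "(real \<Rightarrow> complex) \<Rightarrow> int \<Rightarrow> complex" where
  "fourier_coeff f j =
     (LINT t:{0..1}|lborel. f t * exp (- (2 * \<i> * of_real pi * of_real t * of_int j)))"

text \<open>
  Finiteness of the norm is summability of its nonnegative terms; it makes the Fourier series
  converge absolutely, so the unordered sum over the integers is the right notion of sum.
\<close>

definition B_torus :: "(real \<Rightarrow> complex) set" where
  "B_torus = {f.
     (\<forall>\<alpha>. f (\<alpha> + 1) = f \<alpha>) \<and>
     (\<lambda>j::int. cmod (fourier_coeff f j) * sqrt (ln (real_of_int \<bar>j\<bar> + 3))) summable_on UNIV \<and>
     (\<forall>\<alpha>. ((\<lambda>j::int. fourier_coeff f j * exp (2 * \<i> * of_real pi * of_real \<alpha> * of_int j))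
            has_sum f \<alpha>) UNIV)}"

text \<open>
  The paper's normalisation: this is \<^const>\<open>char\<close> of the law of \<open>Y\<close>, evaluated at \<open>2 * pi * t\<close>.
\<close>

definition char_fun :: "'a measure \<Rightarrow> ('a \<Rightarrow> real) \<Rightarrow> real \<Rightarrow> complex" where
  "char_fun M Y t = (LINT \<omega>|M. exp (2 * \<i> * of_real pi * of_real t * of_real (Y \<omega>)))"

text \<open>
  \<open>\<bbbE>|X\<^sub>k|\<^sup>\<beta> = O(g k)\<close> as \<open>k\<close> tends to infinity. The expectation takes values in
  \<open>[0, \<infinity>]\<close>, whereas the Bochner integral of a non-integrable function is 0, so
  integrability has to be required for all large \<open>k\<close>.
\<close>

definition moments_bigo ::
    "'a measure \<Rightarrow> (nat \<Rightarrow> 'a \<Rightarrow> real) \<Rightarrow> real \<Rightarrow> (nat \<Rightarrow> real) \<Rightarrow> bool" where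
  "moments_bigo M X \<beta> g \<longleftrightarrow>
     (\<forall>\<^sub>F k in sequentially. integrable M (\<lambda>\<omega>. \<bar>X k \<omega>\<bar> powr \<beta>)) \<and>
     (\<lambda>k. LINT \<omega>|M. \<bar>X k \<omega>\<bar> powr \<beta>) \<in> O(g)"

end

theory Submission
  imports Defs
begin

text \<open>
  Expanding \<open>f\<close> in its Fourier series, it suffices to bound the exponential sums
  \<open>\<Sum>k=n..<m. a k * e(j \<alpha> X k)\<close> by \<open>\<epsilon> sqrt (ln (\<bar>j\<bar> + 3))\<close>, uniformly in \<open>\<alpha> \<in> K\<close>, \<open>j \<noteq> 0\<close> and
  large \<open>n \<le> m\<close>. The means of these sums are controlled by hypothesis. By the moment bounds and
  Borel--Cantelli the \<open>X k\<close> may be truncated at levels \<open>R k\<close>. Hoeffding's inequality on a grid of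
  frequencies and Borel--Cantelli then bound the centred sum over \<open>n \<le> k < m\<close> at every frequency \<open>t\<close> by a multiple of
  \<open>sqrt (\<Sum>k\<ge>n. \<bar>a k\<bar>\<^sup>2) * (sqrt (ln (m * R m)) + sqrt (ln (\<bar>t\<bar> + 3)))\<close>.
  Applied to consecutive blocks along which \<open>sqrt (ln (R m))\<close> grows geometrically, these bounds
  add up to a convergent series, by the hypothesis on \<open>a\<close>.
\<close>

subsection \<open>Centred exponential sums\<close>

lemma cis_measurable [measurable]: "cis \<in> borel_measurable borel"
  by (intro borel_measurable_continuous_onI continuous_intros)

lemma char_fun_cis: "char_fun M Y t = (LINT \<omega>|M. cis (2 * pi * t * Y \<omega>))"
  unfolding char_fun_def by (simp add: cis_conv_exp mult_ac)

lemma norm_cis_diff_le: "cmod (cis x - cis y) \<le> \<bar>x - y\<bar>"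
proof -
  have "cis x - cis y = cis y * (cis (x - y) - 1)"
    by (simp add: algebra_simps cis_mult)
  then have "cmod (cis x - cis y) = cmod (cis (x - y) - 1)"
    by (simp add: norm_mult)
  also have "\<dots> \<le> \<bar>x - y\<bar>"
    using abs_sin_x_le_abs_x[of "(x - y) / 2"] dist_exp_i_1[of "x - y"]
    by (simp add: cis_conv_exp)
  finally show ?thesis .
qed

lemma norm_cis_mult_diff_le:
  assumes "\<bar>y\<bar> \<le> r"
  shows "cmod (cis (2 * pi * t * y) - cis (2 * pi * u * y)) \<le> 2 * pi * \<bar>t - u\<bar> * r"
proof -
  have "cmod (cis (2 * pi * t * y) - cis (2 * pi * u * y)) \<le> \<bar>2 * pi * t * y - 2 * pi * u * y\<bar>"
    by (rule norm_cis_diff_le)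
  also have "\<dots> = 2 * pi * \<bar>t - u\<bar> * \<bar>y\<bar>"
    by (simp add: abs_mult flip: left_diff_distrib right_diff_distrib)
  also have "\<dots> \<le> 2 * pi * \<bar>t - u\<bar> * r"
    by (intro mult_left_mono assms) auto
  finally show ?thesis .
qed

lemma summable_inverse_square_shift: "summable (\<lambda>k. 1 / (real k + real c)\<^sup>2)"
proof -
  have "summable (\<lambda>k. inverse (real (k + c) ^ 2))"
    using inverse_power_summable[of 2, where 'a = real] by (subst summable_iff_shift) simp
  then show ?thesis by (simp add: field_simps)
qed


section \<open>Hoeffding's inequality for complex variables\<close>

text \<open>Hoeffding's real inequality is applied to real and imaginary parts, each lying between
  \<open>- c i\<close> and \<open>c i\<close>; two two-sided tails account for the factor 4. Only an
  upper bound \<open>V\<close> for the sum of squares enters, so that one tail of the whole series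
  can serve for every finite block.\<close>

lemma (in prob_space) Hoeffding_complex:
  fixes Z :: "'b \<Rightarrow> 'a \<Rightarrow> complex"
  assumes fin: "finite I" and ind: "indep_vars (\<lambda>_. borel) Z I"
    and bd: "\<And>i \<omega>. i \<in> I \<Longrightarrow> \<omega> \<in> space M \<Longrightarrow> cmod (Z i \<omega>) \<le> c i"
    and V: "(\<Sum>i\<in>I. (c i)\<^sup>2) \<le> V" and x: "0 \<le> x"
  shows "prob {\<omega>\<in>space M. cmod (\<Sum>i\<in>I. Z i \<omega> - expectation (Z i)) > 2 * sqrt (V * x)} \<le> 4 * exp (- x)"
proof -
  have Zm [measurable]: "Z i \<in> borel_measurable M" if "i \<in> I" for i
    using ind that unfolding indep_vars_def by blast
  have int: "integrable M (Z i)" if "i \<in> I" for i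
    by (rule integrable_const_bound[of _ "c i"]) (use bd that in auto)
  have c0: "0 \<le> c i" if "i \<in> I" for i
    using bd[OF that] not_empty norm_ge_zero order_trans by blast
  show ?thesis
  \<comment> \<open>Hoeffding's exponent has the sum of squares as denominator. If it is zero, all
    \<open>Z i\<close> vanish and the event is empty.\<close>
  proof (cases "(\<Sum>i\<in>I. (c i)\<^sup>2) = 0")
    case True
    then have "c i = 0" if "i \<in> I" for i
      using that fin by (simp add: sum_nonneg_eq_0_iff)
    then have Z0: "Z i \<omega> = 0" if "i \<in> I" "\<omega> \<in> space M" for i \<omega>
      using bd that by fastforce
    have E0: "expectation (Z i) = 0" if "i \<in> I" for i
      using Z0 that by (intro integral_eq_zero_AE) auto
    have "V \<ge> 0" using V True by simp
    then have "{\<omega>\<in>space M. cmod (\<Sum>i\<in>I. Z i \<omega> - expectation (Z i)) > 2 * sqrt (V * x)} = {}"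
      using Z0 E0 mult_nonneg_nonneg[OF _ x] by (auto simp: not_less)
    then show ?thesis by (simp only:) simp
  next
    case False
    define W where "W = (\<Sum>i\<in>I. (c i)\<^sup>2)"
    have Wp: "W > 0"
      using False unfolding W_def by (metis order_less_le sum_nonneg zero_le_power2)
    have W4: "(\<Sum>i\<in>I. (c i - - c i)\<^sup>2) = 4 * W"
      unfolding W_def by (simp add: sum_distrib_left power2_eq_square algebra_simps)
    \<comment> \<open>Real and imaginary parts of size at most \<open>e\<close> give modulus at most
      \<open>sqrt 2 * e\<close>, which is \<open>2 * sqrt (V * x)\<close>. The intervals have length
      \<open>2 * c i\<close>, so the exponent \<open>2 * e\<^sup>2 / (4 * W)\<close> equals
      \<open>V * x / W\<close>, which is at least \<open>x\<close>.\<close>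
    define e where "e = sqrt (2 * V * x)"
    have e0: "e \<ge> 0" and e2: "e\<^sup>2 = 2 * V * x" using Wp V x unfolding e_def W_def by auto
    have tail: "exp (- 2 * e\<^sup>2 / (4 * W)) \<le> exp (- x)"
      using Wp V x unfolding e2 W_def[symmetric]
      by (simp add: field_simps mult_right_mono)
    define S :: "(complex \<Rightarrow> real) \<Rightarrow> 'a \<Rightarrow> real"
      where "S = (\<lambda>g \<omega>. (\<Sum>i\<in>I. g (Z i \<omega>)) - (\<Sum>i\<in>I. expectation (\<lambda>\<omega>. g (Z i \<omega>))))"
    have part: "prob {\<omega>\<in>space M. e \<le> \<bar>S g \<omega>\<bar>} \<le> 2 * exp (- x)"
      if g: "g \<in> borel_measurable borel" "\<And>z. \<bar>g z\<bar> \<le> cmod z" for g :: "complex \<Rightarrow> real"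
    proof -
      interpret H: Hoeffding_ineq M I "\<lambda>i \<omega>. g (Z i \<omega>)" "\<lambda>i. - c i" c
          "\<Sum>i\<in>I. expectation (\<lambda>\<omega>. g (Z i \<omega>))"
      proof (unfold_locales)
        show "indep_vars (\<lambda>_. borel) (\<lambda>i \<omega>. g (Z i \<omega>)) I"
          by (rule indep_vars_compose2[OF ind]) (use g in auto)
        fix i assume i: "i \<in> I"
        have "\<bar>g (Z i \<omega>)\<bar> \<le> c i" if "\<omega> \<in> space M" for \<omega>
          using g(2)[of "Z i \<omega>"] bd[OF i that] by linarith
        then show "AE \<omega> in M. g (Z i \<omega>) \<in> {- c i..c i}"
          by (intro AE_I2) (auto simp: abs_le_iff minus_le_iff)
      qed (use fin in auto)
      have "prob {\<omega>\<in>space M. \<bar>(\<Sum>i\<in>I. g (Z i \<omega>)) - (\<Sum>i\<in>I. expectation (\<lambda>\<omega>. g (Z i \<omega>)))\<bar> \<ge> e}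
          \<le> 2 * exp (- 2 * e\<^sup>2 / (\<Sum>i\<in>I. (c i - - c i)\<^sup>2))"
        by (rule H.Hoeffding_ineq_abs_ge) (use e0 W4 Wp in auto)
      then show ?thesis
        using tail unfolding S_def W4 by linarith
    qed
    have Re_le: "prob {\<omega>\<in>space M. e \<le> \<bar>S Re \<omega>\<bar>} \<le> 2 * exp (- x)"
      by (intro part abs_Re_le_cmod) auto
    have Im_le: "prob {\<omega>\<in>space M. e \<le> \<bar>S Im \<omega>\<bar>} \<le> 2 * exp (- x)"
      by (intro part abs_Im_le_cmod) auto
    have S_eq: "(\<Sum>i\<in>I. Z i \<omega> - expectation (Z i)) = Complex (S Re \<omega>) (S Im \<omega>)" for \<omega>
      using int by (simp add: complex_eq_iff S_def sum_subtractf flip: integral_Re integral_Im)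
    have meas [measurable]: "S Re \<in> borel_measurable M" "S Im \<in> borel_measurable M"
      unfolding S_def by measurable
    have "{\<omega>\<in>space M. cmod (\<Sum>i\<in>I. Z i \<omega> - expectation (Z i)) > 2 * sqrt (V * x)}
        \<subseteq> {\<omega>\<in>space M. e \<le> \<bar>S Re \<omega>\<bar>} \<union> {\<omega>\<in>space M. e \<le> \<bar>S Im \<omega>\<bar>}"
    proof (rule subsetI, rule ccontr)
      fix \<omega> assume a: "\<omega> \<in> {\<omega>\<in>space M. cmod (\<Sum>i\<in>I. Z i \<omega> - expectation (Z i)) > 2 * sqrt (V * x)}"
        and "\<omega> \<notin> {\<omega>\<in>space M. e \<le> \<bar>S Re \<omega>\<bar>} \<union> {\<omega>\<in>space M. e \<le> \<bar>S Im \<omega>\<bar>}"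
      then have "\<bar>S Re \<omega>\<bar> \<le> e" "\<bar>S Im \<omega>\<bar> \<le> e" by auto
      then have "(S Re \<omega>)\<^sup>2 + (S Im \<omega>)\<^sup>2 \<le> e\<^sup>2 + e\<^sup>2"
        by (intro add_mono abs_le_square_iff[THEN iffD1]) auto
      also have "\<dots> = 4 * (V * x)" using e2 by simp
      finally have "cmod (Complex (S Re \<omega>) (S Im \<omega>)) \<le> sqrt (4 * (V * x))"
        by (simp add: complex_norm)
      then show False using a unfolding S_eq by (simp add: real_sqrt_mult)
    qed
    then have "prob {\<omega>\<in>space M. cmod (\<Sum>i\<in>I. Z i \<omega> - expectation (Z i)) > 2 * sqrt (V * x)}
        \<le> prob ({\<omega>\<in>space M. e \<le> \<bar>S Re \<omega>\<bar>} \<union> {\<omega>\<in>space M. e \<le> \<bar>S Im \<omega>\<bar>})"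
      by (rule finite_measure_mono) measurable
    also have "\<dots> \<le> prob {\<omega>\<in>space M. e \<le> \<bar>S Re \<omega>\<bar>} + prob {\<omega>\<in>space M. e \<le> \<bar>S Im \<omega>\<bar>}"
      by (rule measure_Un_le) measurable
    also have "\<dots> \<le> 4 * exp (- x)" using Re_le Im_le by simp
    finally show ?thesis .
  qed
qed

section \<open>Centred sums and square-sum tails\<close>

definition centred_sum ::
    "'a measure \<Rightarrow> (nat \<Rightarrow> complex) \<Rightarrow> (nat \<Rightarrow> 'a \<Rightarrow> real) \<Rightarrow> nat \<Rightarrow> nat \<Rightarrow> real \<Rightarrow> 'a \<Rightarrow> complex" where
  "centred_sum M a Y n m t \<omega> =
     (\<Sum>k=n..<m. a k * (cis (2 * pi * t * Y k \<omega>) - char_fun M (Y k) t))"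

text \<open>The infinite sum defaults to 0 when the squares are not summable, so the comparisons
  below assume summability.\<close>

definition l2_tail :: "(nat \<Rightarrow> complex) \<Rightarrow> nat \<Rightarrow> real" where
  "l2_tail a n = sqrt (\<Sum>\<^sub>\<infinity>k\<in>{n..}. (cmod (a k))\<^sup>2)"

lemma l2_tail_nonneg: "0 \<le> l2_tail a n"
  unfolding l2_tail_def by (simp add: infsum_nonneg)

lemma sum_le_l2_tail:
  assumes "(\<lambda>k. (cmod (a k))\<^sup>2) summable_on UNIV"
  shows "(\<Sum>k=n..<m. (cmod (a k))\<^sup>2) \<le> (l2_tail a n)\<^sup>2"
proof -
  have "(\<Sum>k=n..<m. (cmod (a k))\<^sup>2) \<le> (\<Sum>\<^sub>\<infinity>k\<in>{n..}. (cmod (a k))\<^sup>2)"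
    by (rule finite_sum_le_infsum) (auto intro: summable_on_subset_banach[OF assms])
  then show ?thesis
    unfolding l2_tail_def by (simp add: infsum_nonneg)
qed

lemma l2_tail_antimono:
  assumes "(\<lambda>k. (cmod (a k))\<^sup>2) summable_on UNIV" and "n \<le> m"
  shows "l2_tail a m \<le> l2_tail a n"
  unfolding l2_tail_def
  by (intro real_sqrt_le_mono infsum_mono2) (auto intro: summable_on_subset_banach[OF assms(1)] simp: assms)

text \<open>Cauchy-Schwarz against the constant 1, with the number of terms bounded by
  \<open>m\<close>.\<close>

lemma sum_norm_le_l2_tail:
  assumes "(\<lambda>k. (cmod (a k))\<^sup>2) summable_on UNIV"
  shows "(\<Sum>k=n..<m. cmod (a k)) \<le> sqrt (real m) * l2_tail a n"
proof -
  have "(\<Sum>k=n..<m. cmod (a k) * 1) \<le> sqrt ((\<Sum>k=n..<m. (cmod (a k))\<^sup>2) * (\<Sum>k=n..<m. 1\<^sup>2))"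
    by (intro real_le_rsqrt Cauchy_Schwarz_ineq_sum)
  also have "\<dots> \<le> sqrt ((l2_tail a n)\<^sup>2 * real m)"
    by (intro real_sqrt_le_mono mult_mono sum_le_l2_tail assms) auto
  finally show ?thesis by (simp add: real_sqrt_mult l2_tail_nonneg mult.commute)
qed

lemma (in prob_space) integrable_cis:
  assumes [measurable]: "Y \<in> borel_measurable M"
  shows "integrable M (\<lambda>\<omega>. cis (c * Y \<omega>))"
  by (rule integrable_const_bound[of _ 1]) auto

lemma (in prob_space) char_fun_diff_le:
  assumes [measurable]: "Y \<in> borel_measurable M" and bd: "\<And>\<omega>. \<bar>Y \<omega>\<bar> \<le> r"
  shows "cmod (char_fun M Y t - char_fun M Y u) \<le> 2 * pi * \<bar>t - u\<bar> * r"
proof -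
  have "char_fun M Y t - char_fun M Y u = (LINT \<omega>|M. cis (2 * pi * t * Y \<omega>) - cis (2 * pi * u * Y \<omega>))"
    unfolding char_fun_cis by (intro Bochner_Integration.integral_diff[symmetric] integrable_cis) auto
  also have "cmod \<dots> \<le> (LINT \<omega>|M. cmod (cis (2 * pi * t * Y \<omega>) - cis (2 * pi * u * Y \<omega>)))"
    by (rule integral_norm_bound)
  also have "\<dots> \<le> (LINT \<omega>|M. 2 * pi * \<bar>t - u\<bar> * r)"
  proof (rule integral_mono)
    show "integrable M (\<lambda>\<omega>. cmod (cis (2 * pi * t * Y \<omega>) - cis (2 * pi * u * Y \<omega>)))"
      by (intro integrable_norm Bochner_Integration.integrable_diff integrable_cis) auto
  qed (auto intro: norm_cis_mult_diff_le bd)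
  finally show ?thesis by (simp add: prob_space)
qed

text \<open>Each exponential, and hence its mean, is Lipschitz in the frequency with constant
  \<open>2 * pi * r\<close>; the two contributions make \<open>4 * pi\<close>. This carries bounds
  from a grid of frequencies to all of them.\<close>

lemma (in prob_space) centred_sum_diff_le:
  assumes "\<And>k. Y k \<in> borel_measurable M" and bd: "\<And>k \<omega>. k < m \<Longrightarrow> \<bar>Y k \<omega>\<bar> \<le> r"
    and a: "(\<lambda>k. (cmod (a k))\<^sup>2) summable_on UNIV" and r: "0 \<le> r"
  shows "cmod (centred_sum M a Y n m t \<omega> - centred_sum M a Y n m u \<omega>)
    \<le> 4 * pi * \<bar>t - u\<bar> * r * sqrt (real m) * l2_tail a n"
proof -
  have "cmod (centred_sum M a Y n m t \<omega> - centred_sum M a Y n m u \<omega>)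
      = cmod (\<Sum>k=n..<m. a k * ((cis (2 * pi * t * Y k \<omega>) - cis (2 * pi * u * Y k \<omega>))
          - (char_fun M (Y k) t - char_fun M (Y k) u)))"
    unfolding centred_sum_def by (simp add: algebra_simps flip: sum_subtractf)
  also have "\<dots> \<le> (\<Sum>k=n..<m. cmod (a k) * (4 * pi * \<bar>t - u\<bar> * r))"
  proof (rule order_trans[OF norm_sum sum_mono])
    fix k assume k: "k \<in> {n..<m}"
    have "cmod ((cis (2 * pi * t * Y k \<omega>) - cis (2 * pi * u * Y k \<omega>))
          - (char_fun M (Y k) t - char_fun M (Y k) u)) \<le> 2 * pi * \<bar>t - u\<bar> * r + 2 * pi * \<bar>t - u\<bar> * r"
      using k assms by (intro order_trans[OF norm_triangle_ineq4 add_mono] norm_cis_mult_diff_le char_fun_diff_le) auto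
    then have "cmod ((cis (2 * pi * t * Y k \<omega>) - cis (2 * pi * u * Y k \<omega>))
          - (char_fun M (Y k) t - char_fun M (Y k) u)) \<le> 4 * pi * \<bar>t - u\<bar> * r" by linarith
    then show "cmod (a k * ((cis (2 * pi * t * Y k \<omega>) - cis (2 * pi * u * Y k \<omega>))
          - (char_fun M (Y k) t - char_fun M (Y k) u))) \<le> cmod (a k) * (4 * pi * \<bar>t - u\<bar> * r)"
      unfolding norm_mult by (rule mult_left_mono) simp
  qed
  also have "\<dots> = (\<Sum>k=n..<m. cmod (a k)) * (4 * pi * \<bar>t - u\<bar> * r)"
    by (simp add: sum_distrib_right)
  also have "\<dots> \<le> (sqrt (real m) * l2_tail a n) * (4 * pi * \<bar>t - u\<bar> * r)"
    using r by (intro mult_right_mono sum_norm_le_l2_tail a) auto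
  finally show ?thesis by (simp add: mult_ac)
qed

section \<open>Almost sure bounds at all frequencies\<close>

lemma ln_3_ge_1: "1 \<le> ln (3::real)"
  using exp_le by (subst ln_ge_iff) auto

text \<open>Exceptional events are first united over all grid frequencies and over
  \<open>n \<le> m\<close>; Borel-Cantelli in \<open>m\<close> alone then gives one threshold
  \<open>N\<close> for all \<open>n\<close>, \<open>m\<close> and \<open>t\<close>. The Lipschitz
  bound fills the gaps of the grid.\<close>

lemma (in prob_space) AE_centred_sum_le:
  fixes Y :: "nat \<Rightarrow> 'a \<Rightarrow> real" and R :: "nat \<Rightarrow> real"
  assumes ind: "indep_vars (\<lambda>_. borel) Y UNIV"
    and bd: "\<And>k m \<omega>. k < m \<Longrightarrow> \<bar>Y k \<omega>\<bar> \<le> R m" and R1: "\<And>m. 1 \<le> R m"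
    and a: "(\<lambda>k. (cmod (a k))\<^sup>2) summable_on UNIV"
  shows "AE \<omega> in M. \<exists>N. \<forall>n m t. N \<le> n \<longrightarrow> n \<le> m \<longrightarrow>
    cmod (centred_sum M a Y n m t \<omega>)
      \<le> 20 * l2_tail a n * (sqrt (ln (R m * (real m + 2))) + sqrt (ln (\<bar>t\<bar> + 3)))"
proof -
  have Ym [measurable]: "Y k \<in> borel_measurable M" for k
    using ind unfolding indep_vars_def by blast
  have cm [measurable]: "centred_sum M a Y n m t \<in> borel_measurable M" for n m t
    unfolding centred_sum_def by measurable
  \<comment> \<open>Below \<open>\<delta> m\<close> the oscillation of the sums is \<open>O(l2_tail a n)\<close>, so the grid of step \<open>\<delta> m\<close> suffices.
    The thresholds grow with the grid index \<open>q\<close> too, so one union bound handles all real \<open>t\<close>.\<close>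
  define \<delta> where "\<delta> m = 1 / (R m * (real m + 2))" for m
  define x where "x m q = 4 * ln (real m + 2) + 2 * ln (real q + 2)" for m q :: nat
  define E where "E n m q s =
    {\<omega>\<in>space M. cmod (centred_sum M a Y n m (s * real q * \<delta> m) \<omega>) > 2 * sqrt ((l2_tail a n)\<^sup>2 * x m q)}"
    for n m q :: nat and s :: real
  have Emeas [measurable]: "E n m q s \<in> events" for n m q s
    unfolding E_def by measurable
  have x0: "0 \<le> x m q" for m q unfolding x_def by simp
  \<comment> \<open>The weights 4 and 2 in \<open>x\<close> yield a factor summable over
    \<open>q\<close> and a fourth power of \<open>m + 2\<close>; one power is spent on the
    \<open>m + 1\<close> choices of \<open>n\<close>, and summability over \<open>m\<close>
    remains.\<close>
  have exp_x: "exp (- x m q) = 1 / ((real m + 2) ^ 4 * (real q + 2)\<^sup>2)" for m q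
  proof -
    have "exp (x m q) = exp (of_nat 4 * ln (real m + 2)) * exp (of_nat 2 * ln (real q + 2))"
      unfolding x_def by (simp add: exp_add)
    also have "\<dots> = (real m + 2) ^ 4 * (real q + 2)\<^sup>2"
      unfolding exp_of_nat_mult by simp
    finally have "exp (x m q) = (real m + 2) ^ 4 * (real q + 2)\<^sup>2" .
    then show ?thesis by (simp add: exp_minus field_simps)
  qed
  have EP: "prob (E n m q s) \<le> 4 / ((real m + 2) ^ 4 * (real q + 2)\<^sup>2)" for n m q s
  proof -
    define t where "t = s * real q * \<delta> m"
    define Z where "Z k \<omega> = a k * cis (2 * pi * t * Y k \<omega>)" for k \<omega>
    have "prob {\<omega>\<in>space M. cmod (\<Sum>k\<in>{n..<m}. Z k \<omega> - expectation (Z k)) > 2 * sqrt ((l2_tail a n)\<^sup>2 * x m q)}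
        \<le> 4 * exp (- x m q)"
    proof (rule Hoeffding_complex[where c = "\<lambda>k. cmod (a k)"])
      show "indep_vars (\<lambda>_. borel) Z {n..<m}"
        unfolding Z_def by (rule indep_vars_compose2[OF indep_vars_subset[OF ind]]) auto
    qed (use x0 sum_le_l2_tail[OF a] in \<open>auto simp: Z_def norm_mult\<close>)
    moreover have "(\<Sum>k\<in>{n..<m}. Z k \<omega> - expectation (Z k)) = centred_sum M a Y n m t \<omega>" for \<omega>
      unfolding centred_sum_def Z_def char_fun_cis by (simp add: algebra_simps)
    ultimately show ?thesis unfolding E_def t_def exp_x by simp
  qed
  \<comment> \<open>The index \<open>q\<close> is a natural number, so negative frequencies are
    reached through the sign.\<close>
  define G where "G n m q = E n m q 1 \<union> E n m q (- 1)" for n m q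
  define F where "F m = (\<Union>n\<in>{..m}. \<Union>q. G n m q)" for m
  have Gmeas [measurable]: "G n m q \<in> events" for n m q unfolding G_def by measurable
  have Fmeas [measurable]: "F m \<in> events" for m unfolding F_def by measurable
  have GP: "prob (G n m q) \<le> 8 / (real m + 2) ^ 4 * (1 / (real q + 2)\<^sup>2)" for n m q
    using measure_Un_le[OF Emeas Emeas, of n m q 1 n m q "-1"] EP[of n m q 1] EP[of n m q "-1"]
    unfolding G_def by simp
  have inv2: "summable (\<lambda>q. 1 / (real q + 2)\<^sup>2)"
    using summable_inverse_square_shift[of 2] by simp
  define C where "C = (\<Sum>q. 1 / (real q + 2)\<^sup>2)"
  have C0: "0 \<le> C" unfolding C_def by (intro suminf_nonneg inv2) auto
  have UP: "prob (\<Union>q. G n m q) \<le> 8 / (real m + 2) ^ 4 * C" for n m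
  proof -
    have s: "summable (\<lambda>q. prob (G n m q))"
      by (rule summable_comparison_test'[OF summable_mult[OF inv2, of "8 / (real m + 2) ^ 4"], of 0])
        (use GP in auto)
    have "prob (\<Union>q. G n m q) \<le> (\<Sum>q. prob (G n m q))"
      by (rule finite_measure_subadditive_countably) (use s in auto)
    also have "\<dots> \<le> (\<Sum>q. 8 / (real m + 2) ^ 4 * (1 / (real q + 2)\<^sup>2))"
      by (intro suminf_le GP s summable_mult inv2)
    also have "\<dots> = 8 / (real m + 2) ^ 4 * C"
      unfolding C_def by (intro suminf_mult inv2)
    finally show ?thesis .
  qed
  have FP: "prob (F m) \<le> 8 * C * (1 / (real m + 2)\<^sup>2)" for m
  proof -
    have "prob (F m) \<le> (\<Sum>n\<le>m. prob (\<Union>q. G n m q))"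
      unfolding F_def by (rule measure_UNION_le) auto
    also have "\<dots> \<le> (\<Sum>n\<le>m. 8 / (real m + 2) ^ 4 * C)"
      by (intro sum_mono UP)
    also have "\<dots> = 8 * C * ((real m + 1) / (real m + 2) ^ 4)" by simp
    also have "\<dots> \<le> 8 * C * (1 / (real m + 2)\<^sup>2)"
    proof (intro mult_left_mono)
      have "(real m + 1) * (real m + 2)\<^sup>2 \<le> (real m + 2)\<^sup>2 * (real m + 2)\<^sup>2"
        by (intro mult_right_mono) (auto simp: power2_eq_square algebra_simps)
      then show "(real m + 1) / (real m + 2) ^ 4 \<le> 1 / (real m + 2)\<^sup>2"
        by (simp add: divide_simps flip: power_add)
    qed (use C0 in auto)
    finally show ?thesis .
  qed
  have "AE \<omega> in M. eventually (\<lambda>m. \<omega> \<in> space M - F m) sequentially"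
  proof (rule borel_cantelli_AE1)
    show "summable (\<lambda>m. prob (F m))"
      by (rule summable_comparison_test'[OF summable_mult[OF inv2, of "8 * C"], of 0])
        (use FP in auto)
  qed (auto simp: emeasure_eq_measure)
  then show ?thesis
  proof (rule AE_mp, intro AE_I2 impI)
    fix \<omega> assume \<omega>: "\<omega> \<in> space M" and "eventually (\<lambda>m. \<omega> \<in> space M - F m) sequentially"
    then obtain N where N: "\<And>m. N \<le> m \<Longrightarrow> \<omega> \<notin> F m"
      unfolding eventually_sequentially by blast
    show "\<exists>N. \<forall>n m t. N \<le> n \<longrightarrow> n \<le> m \<longrightarrow> cmod (centred_sum M a Y n m t \<omega>)
      \<le> 20 * l2_tail a n * (sqrt (ln (R m * (real m + 2))) + sqrt (ln (\<bar>t\<bar> + 3)))"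
    proof (intro exI[of _ N] allI impI)
      fix n m :: nat and t :: real assume nm: "N \<le> n" "n \<le> m"
      define B where "B = l2_tail a n"
      have B0: "0 \<le> B" unfolding B_def by (rule l2_tail_nonneg)
      define P where "P = R m * (real m + 2)"
      have Pm: "real m + 2 \<le> P" unfolding P_def using R1[of m] by (simp add: mult_le_cancel_right1)
      define L where "L = ln P"
      define T where "T = ln (\<bar>t\<bar> + 3)"
      have T1: "1 \<le> T" unfolding T_def using ln_3_ge_1 by (rule order_trans) simp
      have L0: "0 \<le> L" unfolding L_def using Pm by simp
      have P2: "2 \<le> P" using Pm by simp
      define s :: real where "s = (if t \<ge> 0 then 1 else - 1)"
      \<comment> \<open>The grid has step \<open>1 / P\<close>, and \<open>u\<close> below is
        \<open>t\<close> rounded towards 0 on it.\<close>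
      define q where "q = nat \<lfloor>\<bar>t\<bar> * P\<rfloor>"
      have q: "real q \<le> \<bar>t\<bar> * P" "\<bar>t\<bar> * P \<le> real q + 1"
      proof -
        have "0 \<le> \<bar>t\<bar> * P" using P2 by simp
        then have "real q = of_int \<lfloor>\<bar>t\<bar> * P\<rfloor>" unfolding q_def by simp
        then show "real q \<le> \<bar>t\<bar> * P" "\<bar>t\<bar> * P \<le> real q + 1" by linarith+
      qed
      define u where "u = s * real q * \<delta> m"
      have u: "u = s * (real q / P)" unfolding u_def \<delta>_def P_def by simp
      have qP: "real q / P \<le> \<bar>t\<bar>" "\<bar>t\<bar> \<le> real q / P + 1 / P"
        using q P2 by (simp_all add: field_simps)
      have tu: "\<bar>t - u\<bar> \<le> 1 / P"
        unfolding u s_def using qP by (cases "0 \<le> t"; simp; linarith)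
      have "\<omega> \<notin> E n m q s"
        using N[of m] nm unfolding F_def G_def s_def by auto
      then have "cmod (centred_sum M a Y n m u \<omega>) \<le> 2 * sqrt (B\<^sup>2 * x m q)"
        using \<omega> unfolding E_def u_def B_def by (simp add: not_less)
      also have "\<dots> = 2 * B * sqrt (x m q)" using B0 by (simp add: real_sqrt_mult)
      also have "\<dots> \<le> 2 * B * (3 * (sqrt L + sqrt T))"
      proof (intro mult_left_mono)
        have "ln (real m + 2) \<le> L" unfolding L_def using Pm by (intro ln_mono) auto
        \<comment> \<open>The index \<open>q\<close> is at most \<open>\<bar>t\<bar> * P\<close>, so
          its logarithm splits into the cost \<open>L\<close> of the grid step and the cost
          \<open>T\<close> of the frequency.\<close>
        moreover have "ln (real q + 2) \<le> L + T"
        proof -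
          have "real q + 2 \<le> \<bar>t\<bar> * P + P" using q P2 by linarith
          also have "\<dots> \<le> P * (\<bar>t\<bar> + 3)" using P2 by (simp add: algebra_simps)
          finally have "ln (real q + 2) \<le> ln (P * (\<bar>t\<bar> + 3))" by (intro ln_mono) auto
          also have "\<dots> = L + T" unfolding L_def T_def using P2 by (intro ln_mult_pos) auto
          finally show ?thesis .
        qed
        \<comment> \<open>The left side is at most \<open>6 * L + 2 * T\<close>; 9 is a convenient
          square, giving the factor 3 below.\<close>
        moreover have "4 * p + 2 * r \<le> 9 * (L + T)" if "p \<le> L" "r \<le> L + T" for p r
          using that L0 T1 by (simp add: algebra_simps)
        ultimately have "x m q \<le> 9 * (L + T)" unfolding x_def by blast
        then have "sqrt (x m q) \<le> sqrt (9 * (L + T))" by simp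
        also have "\<dots> = 3 * sqrt (L + T)" unfolding real_sqrt_mult by simp
        also have "\<dots> \<le> 3 * (sqrt L + sqrt T)"
          using L0 T1 by (intro mult_left_mono sqrt_add_le_add_sqrt) auto
        finally show "sqrt (x m q) \<le> 3 * (sqrt L + sqrt T)" .
      qed (use B0 in auto)
      finally have c1: "cmod (centred_sum M a Y n m u \<omega>) \<le> 6 * B * (sqrt L + sqrt T)"
        by (simp add: algebra_simps)
      \<comment> \<open>The factor \<open>1 / P\<close> cancels \<open>R m\<close> and outweighs
        \<open>sqrt m\<close>. Rounding \<open>4 * pi\<close> up to 14 and adding the 6 of the grid
        value gives 20.\<close>
      have "cmod (centred_sum M a Y n m t \<omega> - centred_sum M a Y n m u \<omega>)
          \<le> 4 * pi * \<bar>t - u\<bar> * R m * sqrt (real m) * B"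
        unfolding B_def using R1[of m] by (intro centred_sum_diff_le bd a) auto
      also have "\<dots> \<le> 4 * pi * (1 / P) * R m * (real m + 2) * B"
      proof (intro mult_right_mono mult_mono mult_left_mono tu)
        show "sqrt (real m) \<le> real m + 2"
          by (rule real_le_lsqrt) (auto simp: power2_eq_square algebra_simps)
      qed (use B0 R1[of m] P2 in auto)
      also have "\<dots> = 4 * pi * B" using P2 unfolding P_def by (auto simp: field_simps)
      also have "\<dots> \<le> 14 * B" using pi_less_4 pi_approx B0 by (intro mult_right_mono) auto
      also have "\<dots> \<le> 14 * B * (sqrt L + sqrt T)"
        using B0 T1 L0 real_sqrt_ge_one[OF T1] by (simp add: mult_le_cancel_left1 add_increasing)
      finally have c2: "cmod (centred_sum M a Y n m t \<omega> - centred_sum M a Y n m u \<omega>)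
          \<le> 14 * B * (sqrt L + sqrt T)" .
      have "cmod (centred_sum M a Y n m t \<omega>) \<le> cmod (centred_sum M a Y n m u \<omega>)
          + cmod (centred_sum M a Y n m t \<omega> - centred_sum M a Y n m u \<omega>)"
        by (rule norm_triangle_sub)
      also have "\<dots> \<le> 20 * B * (sqrt L + sqrt T)" using c1 c2 by (simp add: algebra_simps)
      finally show "cmod (centred_sum M a Y n m t \<omega>)
        \<le> 20 * l2_tail a n * (sqrt (ln (R m * (real m + 2))) + sqrt (ln (\<bar>t\<bar> + 3)))"
        unfolding B_def L_def T_def P_def .
    qed
  qed
qed

subsection \<open>Sums over blocks\<close>

text \<open>Induction on the last block: a range straddling \<open>N i\<close> is cut there. The
  block bound is assumed for all subranges of a block, so that incomplete pieces at either end cost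
  no more than full blocks.\<close>

lemma norm_sum_blocks_le:
  fixes u :: "nat \<Rightarrow> 'a::real_normed_vector"
  assumes N: "mono N" and b: "\<And>i. 0 \<le> b i"
    and blk: "\<And>i n m. i0 \<le> i \<Longrightarrow> N i \<le> n \<Longrightarrow> n \<le> m \<Longrightarrow> m \<le> N (Suc i) \<Longrightarrow> norm (sum u {n..<m}) \<le> b i"
    and "i0 \<le> i1" and "N i0 \<le> n" and "n \<le> m" and "m \<le> N i1"
  shows "norm (sum u {n..<m}) \<le> sum b {i0..<i1}"
  using assms(4-)
proof (induction i1 arbitrary: n m rule: dec_induct)
  case base
  then show ?case by simp
next
  case (step i)
  have b': "0 \<le> sum b {i0..<i}" by (intro sum_nonneg b)
  consider "m \<le> N i" | "N i \<le> n" | "n \<le> N i" "N i \<le> m" by linarith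
  then show ?case
  proof cases
    case 1
    then have "norm (sum u {n..<m}) \<le> sum b {i0..<i}" using step by blast
    then show ?thesis using b[of i] step.hyps by simp
  next
    case 2
    then have "norm (sum u {n..<m}) \<le> b i" using step blk by blast
    then show ?thesis using b' step.hyps by simp
  next
    case 3
    have "sum u {n..<m} = sum u {n..<N i} + sum u {N i..<m}"
      using 3 by (simp add: sum.atLeastLessThan_concat)
    also have "norm \<dots> \<le> norm (sum u {n..<N i}) + norm (sum u {N i..<m})"
      by (rule norm_triangle_ineq)
    also have "\<dots> \<le> sum b {i0..<i} + b i"
    proof (rule add_mono)
      show "norm (sum u {n..<N i}) \<le> sum b {i0..<i}" using 3 step by blast
      show "norm (sum u {N i..<m}) \<le> b i" using 3 step blk by blast
    qed
    finally show ?thesis using step.hyps by simp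
  qed
qed

text \<open>A condensation argument. As \<open>B\<close> decreases, its value at the end of a block
  times the increment of \<open>g\<close> over that block is at most the part of the given series in
  the block; the blocks are disjoint, so these parts are summable.\<close>

lemma summable_blocks:
  fixes B g :: "nat \<Rightarrow> real"
  assumes B: "antimono B" "\<And>n. 0 \<le> B n" and g: "mono_on {n0..} g"
    and sm: "summable (\<lambda>n. B n * (g (Suc n) - g n))"
    and N: "strict_mono N" and gN: "\<And>i. g (N i) = c * r ^ i" and r: "1 < r" and n0: "n0 \<le> N 0" and c: "0 \<le> c"
  shows "summable (\<lambda>i. B (N i) * g (N (Suc i)))"
proof -
  define w where "w n = B n * (g (Suc n) - g n)" for n
  have w0: "0 \<le> w n" if "n0 \<le> n" for n
    unfolding w_def using B that by (intro mult_nonneg_nonneg) (auto intro!: mono_onD[OF g])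
  have Nmono: "N i \<le> N j" if "i \<le> j" for i j
    using N that by (simp add: strict_mono_less_eq)
  have Nge: "n0 \<le> N i" for i using Nmono[of 0 i] n0 by simp
  have tel: "(\<Sum>n=N i..<N (Suc i). g (Suc n) - g n) = c * r ^ i * (r - 1)" for i
    using Nmono[of i "Suc i"] by (subst sum_Suc_diff') (auto simp: gN algebra_simps)
  \<comment> \<open>Geometric growth of \<open>g\<close> along \<open>N\<close>: \<open>g (N (i + 2))\<close> is a fixed multiple of the increment of \<open>g\<close> over block \<open>i\<close>.\<close>
  have step: "B (N (Suc i)) * (c * r ^ i * (r - 1)) \<le> sum w {N i..<N (Suc i)}" for i
  proof -
    have "B (N (Suc i)) * (c * r ^ i * (r - 1)) = (\<Sum>n=N i..<N (Suc i). B (N (Suc i)) * (g (Suc n) - g n))"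
      by (simp add: sum_distrib_left flip: tel)
    also have "\<dots> \<le> sum w {N i..<N (Suc i)}"
      unfolding w_def using Nge[of i]
      by (intro sum_mono mult_right_mono antimonoD[OF B(1)]) (auto intro!: mono_onD[OF g])
    finally show ?thesis .
  qed
  have cover: "(\<Sum>i<k. sum w {N i..<N (Suc i)}) = sum w {N 0..<N k}" for k
    using Nmono by (induction k) (auto simp: sum.atLeastLessThan_concat)
  have "summable (\<lambda>i. sum w {N i..<N (Suc i)})"
  proof (rule summableI_nonneg_bounded)
    show "0 \<le> sum w {N i..<N (Suc i)}" for i
      using Nge[of i] by (intro sum_nonneg w0) auto
    \<comment> \<open>Monotonicity of \<open>g\<close> is known only from \<open>n0\<close> on;
      earlier terms are replaced by 0 so that all terms are nonnegative.\<close>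
    have sw: "summable (\<lambda>n. if n < n0 then 0 else w n)"
      by (rule summable_cong[THEN iffD1, OF _ sm])
        (auto simp: w_def eventually_sequentially intro!: exI[of _ n0])
    fix k
    have "(\<Sum>i<k. sum w {N i..<N (Suc i)}) = sum (\<lambda>n. if n < n0 then 0 else w n) {N 0..<N k}"
      unfolding cover using n0 by (intro sum.cong) auto
    also have "\<dots> \<le> (\<Sum>n. if n < n0 then 0 else w n)"
      by (rule sum_le_suminf[OF sw]) (auto intro: w0)
    finally show "(\<Sum>i<k. sum w {N i..<N (Suc i)}) \<le> (\<Sum>n. if n < n0 then 0 else w n)" .
  qed
  then have "summable (\<lambda>i. r\<^sup>2 / (r - 1) * sum w {N i..<N (Suc i)})"
    by (rule summable_mult)
  moreover have "norm (B (N (Suc i)) * g (N (Suc (Suc i)))) \<le> r\<^sup>2 / (r - 1) * sum w {N i..<N (Suc i)}" for i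
  proof -
    have "norm (B (N (Suc i)) * g (N (Suc (Suc i)))) = r\<^sup>2 / (r - 1) * (B (N (Suc i)) * (c * r ^ i * (r - 1)))"
      using r B c by (simp add: gN power2_eq_square field_simps)
    also have "\<dots> \<le> r\<^sup>2 / (r - 1) * sum w {N i..<N (Suc i)}"
      using r by (intro mult_left_mono step) auto
    finally show ?thesis .
  qed
  ultimately have "summable (\<lambda>i. B (N (Suc i)) * g (N (Suc (Suc i))))"
    by (rule summable_comparison_test'[where N = 0])
  then show ?thesis by (subst (asm) summable_Suc_iff)
qed

subsection \<open>Fourier expansion\<close>

lemma B_torus_expansion:
  assumes "f \<in> B_torus"
  shows "((\<lambda>j. fourier_coeff f j * cis (2 * pi * x * of_int j)) has_sum f x) UNIV"
    and "(\<lambda>j. cmod (fourier_coeff f j) * sqrt (ln (real_of_int \<bar>j\<bar> + 3))) summable_on UNIV"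
  using assms by (auto simp: B_torus_def cis_conv_exp mult_ac)

lemma sqrt_ln_ge_1: "1 \<le> sqrt (ln (\<bar>x\<bar> + 3))"
proof -
  have "exp 1 \<le> \<bar>x\<bar> + 3" using exp_le by linarith
  then show ?thesis by (simp add: ln_ge_iff)
qed

text \<open>Since the weights are at least 1, the terms of the norm majorise the Fourier series,
  which is then a uniform limit of trigonometric polynomials.\<close>

lemma B_torus_continuous:
  assumes f: "f \<in> B_torus"
  shows "continuous_on UNIV f"
proof (rule uniform_limit_theorem)
  show "uniform_limit UNIV (\<lambda>F x. \<Sum>j\<in>F. fourier_coeff f j * cis (2 * pi * x * of_int j)) f (finite_subsets_at_top UNIV)"
  proof (rule Weierstrass_m_test_general'[OF _ _ B_torus_expansion(2)[OF f]])
    fix j :: int and x :: real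
    show "cmod (fourier_coeff f j * cis (2 * pi * x * of_int j))
        \<le> cmod (fourier_coeff f j) * sqrt (ln (real_of_int \<bar>j\<bar> + 3))"
      using sqrt_ln_ge_1[of "of_int j"] by (simp add: norm_mult mult_le_cancel_left1)
  qed (use B_torus_expansion(1)[OF f] in auto)
  show "\<forall>\<^sub>F F in finite_subsets_at_top UNIV. continuous_on UNIV (\<lambda>x. \<Sum>j\<in>F. fourier_coeff f j * cis (2 * pi * x * of_int j))"
    by (intro always_eventually allI continuous_intros)
qed simp

lemma fourier_coeff_0: "fourier_coeff f 0 = (LINT t:{0..1}|lborel. f t)"
  by (simp add: fourier_coeff_def)

lemma has_sum_sum:
  fixes F :: "'i \<Rightarrow> 'b \<Rightarrow> 'c::topological_comm_monoid_add"
  assumes "\<And>i. i \<in> I \<Longrightarrow> (F i has_sum s i) A"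
  shows "((\<lambda>x. \<Sum>i\<in>I. F i x) has_sum (\<Sum>i\<in>I. s i)) A"
  using assms by (induction I rule: infinite_finite_induct) (auto intro: has_sum_add)

text \<open>The Fourier series is interchanged with the finite sum over \<open>k\<close>. The zero
  mean removes the frequency \<open>j = 0\<close>, the only one not covered by \<open>bd\<close>,
  and the weight in the norm absorbs the growth of the bound in \<open>j\<close>.\<close>

lemma B_torus_sum_le:
  assumes f: "f \<in> B_torus" and f0: "(LINT t:{0..1}|lborel. f t) = 0"
    and bd: "\<And>j::int. j \<noteq> 0 \<Longrightarrow>
      cmod (\<Sum>k\<in>I. a k * cis (2 * pi * (of_int j * \<alpha>) * y k)) \<le> e * sqrt (ln (real_of_int \<bar>j\<bar> + 3))"
  shows "cmod (\<Sum>k\<in>I. a k * f (\<alpha> * y k))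
    \<le> e * (\<Sum>\<^sub>\<infinity>j. cmod (fourier_coeff f j) * sqrt (ln (real_of_int \<bar>j\<bar> + 3)))"
proof (rule norm_infsum_le)
  show "((\<lambda>j. \<Sum>k\<in>I. a k * (fourier_coeff f j * cis (2 * pi * (\<alpha> * y k) * of_int j)))
      has_sum (\<Sum>k\<in>I. a k * f (\<alpha> * y k))) UNIV"
    by (intro has_sum_sum has_sum_cmult_right B_torus_expansion f)
  show "((\<lambda>j. e * (cmod (fourier_coeff f j) * sqrt (ln (real_of_int \<bar>j\<bar> + 3))))
      has_sum (e * (\<Sum>\<^sub>\<infinity>j. cmod (fourier_coeff f j) * sqrt (ln (real_of_int \<bar>j\<bar> + 3))))) UNIV"
    by (intro has_sum_cmult_right has_sum_infsum B_torus_expansion f)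
  fix j :: int
  show "cmod (\<Sum>k\<in>I. a k * (fourier_coeff f j * cis (2 * pi * (\<alpha> * y k) * of_int j)))
      \<le> e * (cmod (fourier_coeff f j) * sqrt (ln (real_of_int \<bar>j\<bar> + 3)))"
  proof (cases "j = 0")
    case True
    then show ?thesis using f0 by (simp add: fourier_coeff_0)
  next
    case False
    have "(\<Sum>k\<in>I. a k * (fourier_coeff f j * cis (2 * pi * (\<alpha> * y k) * of_int j)))
        = fourier_coeff f j * (\<Sum>k\<in>I. a k * cis (2 * pi * (of_int j * \<alpha>) * y k))"
      by (simp add: sum_distrib_left mult_ac)
    then show ?thesis
      using mult_left_mono[OF bd[OF False], of "cmod (fourier_coeff f j)"]
      by (simp add: norm_mult mult_ac)
  qed
qed

text \<open>A property of a single realisation \<open>y\<close> that does not mention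
  \<open>f\<close>: this is why one almost sure event serves all of \<open>B_torus\<close>. The
  permitted growth in \<open>j\<close> is the weight of the norm.\<close>

definition exp_sums_small :: "(nat \<Rightarrow> complex) \<Rightarrow> (nat \<Rightarrow> real) \<Rightarrow> real set \<Rightarrow> bool" where
  "exp_sums_small a y K \<longleftrightarrow> (\<forall>e>0. \<exists>N. \<forall>n m \<alpha>. \<forall>j::int. N \<le> n \<longrightarrow> n \<le> m \<longrightarrow> \<alpha> \<in> K \<longrightarrow> j \<noteq> 0 \<longrightarrow>
      cmod (\<Sum>k=n..<m. a k * cis (2 * pi * (of_int j * \<alpha>) * y k))
        \<le> e * sqrt (ln (real_of_int \<bar>j\<bar> + 3)))"

lemma exp_sums_small_uniform_limit:
  assumes f: "f \<in> B_torus" and f0: "(LINT t:{0..1}|lborel. f t) = 0"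
    and y: "exp_sums_small a y K"
  shows "uniform_limit K (\<lambda>n \<alpha>. \<Sum>k<n. a k * f (\<alpha> * y k)) (\<lambda>\<alpha>. \<Sum>k. a k * f (\<alpha> * y k)) sequentially"
    (is "uniform_limit K ?S _ _")
proof -
  define V where "V = (\<Sum>\<^sub>\<infinity>j. cmod (fourier_coeff f j) * sqrt (ln (real_of_int \<bar>j\<bar> + 3)))"
  have V0: "0 \<le> V" unfolding V_def using sqrt_ln_ge_1[of "of_int _"] by (intro infsum_nonneg) (simp add: zero_le_mult_iff)
  have "uniformly_Cauchy_on K ?S"
  proof (rule uniformly_Cauchy_onI')
    fix e :: real assume e: "0 < e"
    \<comment> \<open>Adding 1 avoids division by zero and makes the final inequality
      strict.\<close>
    then have "0 < e / (V + 1)" using V0 by simp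
    then obtain N where N: "\<And>n m \<alpha> j. N \<le> n \<Longrightarrow> n \<le> m \<Longrightarrow> \<alpha> \<in> K \<Longrightarrow> j \<noteq> 0 \<Longrightarrow>
      cmod (\<Sum>k=n..<m. a k * cis (2 * pi * (of_int j * \<alpha>) * y k))
        \<le> e / (V + 1) * sqrt (ln (real_of_int \<bar>j\<bar> + 3))"
      using y unfolding exp_sums_small_def by blast
    show "\<exists>N. \<forall>\<alpha>\<in>K. \<forall>m\<ge>N. \<forall>n>m. dist (?S m \<alpha>) (?S n \<alpha>) < e"
    proof (intro exI[of _ N] ballI allI impI)
      fix \<alpha> m n assume *: "\<alpha> \<in> K" "N \<le> m" "m < (n::nat)"
      have "dist (?S m \<alpha>) (?S n \<alpha>) = cmod (\<Sum>k=m..<n. a k * f (\<alpha> * y k))"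
        using * sum_diff_nat_ivl[of 0 m n "\<lambda>k. a k * f (\<alpha> * y k)"]
        by (simp add: dist_norm norm_minus_commute[of "?S m \<alpha>"] atLeast0LessThan)
      also have "\<dots> \<le> e / (V + 1) * V"
        unfolding V_def by (rule B_torus_sum_le[OF f f0]) (rule N[unfolded V_def]; use * in simp)
      also have "\<dots> < e" using e V0 by (simp add: field_simps)
      finally show "dist (?S m \<alpha>) (?S n \<alpha>) < e" .
    qed
  qed
  then have "uniformly_convergent_on K ?S"
    by (rule Cauchy_uniformly_convergent)
  then have "uniform_limit K ?S (\<lambda>\<alpha>. lim (\<lambda>n. ?S n \<alpha>)) sequentially"
    by (simp add: uniformly_convergent_uniform_limit_iff)
  moreover have "lim (\<lambda>n. ?S n \<alpha>) = (\<Sum>k. a k * f (\<alpha> * y k))" for \<alpha>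
    by (simp add: suminf_eq_lim)
  ultimately show ?thesis by simp
qed

text \<open>Singletons give pointwise convergence. Every nonzero \<alpha> has the compact
  neighbourhood \<open>cball \<alpha> (\<bar>\<alpha>\<bar> / 2)\<close> avoiding 0, so uniform
  convergence on such sets gives continuity.\<close>

lemma exp_sums_small_conclusion:
  assumes f: "f \<in> B_torus" and f0: "(LINT t:{0..1}|lborel. f t) = 0"
    and y: "\<And>K. compact K \<Longrightarrow> 0 \<notin> K \<Longrightarrow> exp_sums_small a y K"
  shows "(\<forall>\<alpha>. \<alpha> \<noteq> 0 \<longrightarrow> summable (\<lambda>k. a k * f (\<alpha> * y k))) \<and>
    continuous_on (UNIV - {0}) (\<lambda>\<alpha>. \<Sum>k. a k * f (\<alpha> * y k)) \<and>
    (\<forall>K. compact K \<and> 0 \<notin> K \<longrightarrow>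
      uniform_limit K (\<lambda>n \<alpha>. \<Sum>k<n. a k * f (\<alpha> * y k)) (\<lambda>\<alpha>. \<Sum>k. a k * f (\<alpha> * y k)) sequentially)"
proof (intro conjI allI impI)
  show ul: "uniform_limit K (\<lambda>n \<alpha>. \<Sum>k<n. a k * f (\<alpha> * y k)) (\<lambda>\<alpha>. \<Sum>k. a k * f (\<alpha> * y k)) sequentially"
    if "compact K \<and> 0 \<notin> K" for K
    using exp_sums_small_uniform_limit[OF f f0 y] that by blast
  show "summable (\<lambda>k. a k * f (\<alpha> * y k))" if "\<alpha> \<noteq> 0" for \<alpha>
  proof -
    have "(\<lambda>n. \<Sum>k<n. a k * f (\<alpha> * y k)) \<longlonglongrightarrow> (\<Sum>k. a k * f (\<alpha> * y k))"
      by (rule tendsto_uniform_limitI[OF ul[of "{\<alpha>}"]]) (use that in auto)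
    then show ?thesis unfolding summable_def sums_def by blast
  qed
  show "continuous_on (UNIV - {0}) (\<lambda>\<alpha>. \<Sum>k. a k * f (\<alpha> * y k))"
  proof (rule continuous_at_imp_continuous_on, rule ballI)
    fix \<alpha> :: real assume "\<alpha> \<in> UNIV - {0}"
    then have \<alpha>: "\<alpha> \<noteq> 0" by simp
    define K where "K = cball \<alpha> (\<bar>\<alpha>\<bar> / 2)"
    have "compact K" "0 \<notin> K" using \<alpha> by (auto simp: K_def dist_real_def)
    then have "continuous_on K (\<lambda>\<alpha>. \<Sum>k. a k * f (\<alpha> * y k))"
      by (intro uniform_limit_theorem[OF _ ul])
        (auto intro!: always_eventually continuous_intros continuous_on_compose2[OF B_torus_continuous[OF f]])
    moreover have "\<alpha> \<in> interior K" using \<alpha> by (auto simp: K_def)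
    ultimately show "isCont (\<lambda>\<alpha>. \<Sum>k. a k * f (\<alpha> * y k)) \<alpha>"
      by (rule continuous_on_interior)
  qed
qed

subsection \<open>Truncation\<close>

text \<open>The integrands agree off \<open>E\<close> and differ by at most 2 on it.\<close>

lemma (in prob_space) char_fun_cong_le:
  assumes [measurable]: "X \<in> borel_measurable M" "Y \<in> borel_measurable M" "E \<in> events"
    and eq: "\<And>\<omega>. \<omega> \<in> space M \<Longrightarrow> \<omega> \<notin> E \<Longrightarrow> X \<omega> = Y \<omega>"
  shows "cmod (char_fun M X t - char_fun M Y t) \<le> 2 * prob E"
proof -
  have "char_fun M X t - char_fun M Y t = (LINT \<omega>|M. cis (2 * pi * t * X \<omega>) - cis (2 * pi * t * Y \<omega>))"
    unfolding char_fun_cis by (intro Bochner_Integration.integral_diff[symmetric] integrable_cis) auto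
  also have "cmod \<dots> \<le> (LINT \<omega>|M. cmod (cis (2 * pi * t * X \<omega>) - cis (2 * pi * t * Y \<omega>)))"
    by (rule integral_norm_bound)
  also have "\<dots> \<le> (LINT \<omega>|M. 2 * indicator E \<omega>)"
  proof (rule integral_mono)
    show "integrable M (\<lambda>\<omega>. cmod (cis (2 * pi * t * X \<omega>) - cis (2 * pi * t * Y \<omega>)))"
      by (intro integrable_norm Bochner_Integration.integrable_diff integrable_cis) auto
    fix \<omega> assume "\<omega> \<in> space M"
    then show "cmod (cis (2 * pi * t * X \<omega>) - cis (2 * pi * t * Y \<omega>)) \<le> 2 * indicator E \<omega>"
      using eq[of \<omega>] norm_triangle_ineq4[of "cis (2 * pi * t * X \<omega>)" "cis (2 * pi * t * Y \<omega>)"]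
      by (cases "\<omega> \<in> E") auto
  qed (auto simp: emeasure_eq_measure)
  finally show ?thesis by simp
qed

lemma norm_le_l2_tail_0:
  assumes "(\<lambda>k. (cmod (a k))\<^sup>2) summable_on UNIV"
  shows "cmod (a k) \<le> l2_tail a 0"
proof -
  have "(cmod (a k))\<^sup>2 \<le> (\<Sum>k=0..<Suc k. (cmod (a k))\<^sup>2)"
    by (rule member_le_sum) auto
  also have "\<dots> \<le> (l2_tail a 0)\<^sup>2" by (rule sum_le_l2_tail[OF assms])
  finally show ?thesis by (rule power2_le_imp_le) (rule l2_tail_nonneg)
qed

text \<open>Converts growth in the frequency into growth in \<open>j\<close> for bounded \<alpha>.
  The logarithm turns the product \<open>(A + 1) * (\<bar>j\<bar> + 3)\<close> into a sum, and the
  additive constant is absorbed because the other root is at least 1.\<close>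

lemma sqrt_ln_mult_le:
  fixes j :: int
  assumes "\<bar>\<alpha>\<bar> \<le> A"
  shows "sqrt (ln (\<bar>of_int j * \<alpha>\<bar> + 3)) \<le> (sqrt (ln (A + 1)) + 1) * sqrt (ln (real_of_int \<bar>j\<bar> + 3))"
proof -
  have A: "0 \<le> A" using assms by linarith
  have "\<bar>of_int j * \<alpha>\<bar> + 3 \<le> (A + 1) * (real_of_int \<bar>j\<bar> + 3)"
  proof -
    have "\<bar>of_int j * \<alpha>\<bar> \<le> real_of_int \<bar>j\<bar> * A"
      using assms by (simp add: abs_mult mult_left_mono)
    then show ?thesis using A by (simp add: algebra_simps)
  qed
  then have "ln (\<bar>of_int j * \<alpha>\<bar> + 3) \<le> ln ((A + 1) * (real_of_int \<bar>j\<bar> + 3))"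
    by (intro ln_mono) auto
  also have "\<dots> = ln (A + 1) + ln (real_of_int \<bar>j\<bar> + 3)"
    using A by (intro ln_mult_pos) auto
  finally have "sqrt (ln (\<bar>of_int j * \<alpha>\<bar> + 3)) \<le> sqrt (ln (A + 1) + ln (real_of_int \<bar>j\<bar> + 3))"
    by simp
  also have "\<dots> \<le> sqrt (ln (A + 1)) * 1 + sqrt (ln (real_of_int \<bar>j\<bar> + 3))"
    using A sqrt_add_le_add_sqrt[of "ln (A + 1)" "ln (real_of_int \<bar>j\<bar> + 3)"] by simp
  also have "\<dots> \<le> sqrt (ln (A + 1)) * sqrt (ln (real_of_int \<bar>j\<bar> + 3)) + sqrt (ln (real_of_int \<bar>j\<bar> + 3))"
    using A sqrt_ln_ge_1[of "of_int j"] by (intro add_right_mono mult_left_mono) auto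
  finally show ?thesis by (simp add: algebra_simps)
qed

text \<open>Eventually \<open>X k\<close> equals its truncation \<open>Y k\<close>, and the sum
  splits into a centred sum of \<open>Y\<close>, the means of \<open>X\<close>, and the difference
  of the means. Each gets a third of \<open>e\<close>: by the almost sure bound along the blocks, by
  \<open>char\<close>, and by summability of the truncation probabilities.\<close>

lemma (in prob_space) AE_exp_sums_small:
  fixes X :: "nat \<Rightarrow> 'a \<Rightarrow> real" and R g :: "nat \<Rightarrow> real"
  assumes ind: "indep_vars (\<lambda>_. borel) X UNIV"
    and a: "(\<lambda>k. (cmod (a k))\<^sup>2) summable_on UNIV"
    and R: "mono R" "\<And>k. 1 \<le> R k"
    and XR: "summable (\<lambda>k. prob {\<omega>\<in>space M. R k < \<bar>X k \<omega>\<bar>})"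
    and Rg: "\<And>m. 2 \<le> m \<Longrightarrow> sqrt (ln (R m * (real m + 2))) \<le> c * g m"
    and N: "strict_mono N" "2 \<le> N 0"
    and blocks: "summable (\<lambda>i. l2_tail a (N i) * g (N (Suc i)))"
    and char: "\<And>K e. compact K \<Longrightarrow> 0 \<notin> K \<Longrightarrow> 0 < e \<Longrightarrow> \<exists>N. \<forall>n m \<alpha>. \<forall>j::int. N \<le> n \<longrightarrow> n \<le> m \<longrightarrow> \<alpha> \<in> K \<longrightarrow> j \<noteq> 0 \<longrightarrow>
      cmod (\<Sum>k=n..<m. a k * char_fun M (X k) (of_int j * \<alpha>)) \<le> e"
  shows "AE \<omega> in M. \<forall>K. compact K \<longrightarrow> 0 \<notin> K \<longrightarrow> exp_sums_small a (\<lambda>k. X k \<omega>) K"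
proof -
  have Xm [measurable]: "X k \<in> borel_measurable M" for k
    using ind unfolding indep_vars_def by blast
  \<comment> \<open>Replacing large values by 0 keeps \<open>Y k\<close> a function of
    \<open>X k\<close> alone, which preserves independence.\<close>
  define Y where "Y k \<omega> = (if \<bar>X k \<omega>\<bar> \<le> R k then X k \<omega> else 0)" for k \<omega>
  define E where "E k = {\<omega>\<in>space M. R k < \<bar>X k \<omega>\<bar>}" for k
  have Em [measurable]: "E k \<in> events" for k unfolding E_def by measurable
  have Ym [measurable]: "Y k \<in> borel_measurable M" for k unfolding Y_def by measurable
  have indY: "indep_vars (\<lambda>_. borel) Y UNIV"
    unfolding Y_def by (rule indep_vars_compose2[OF ind]) measurable
  have YR: "\<bar>Y k \<omega>\<bar> \<le> R m" if "k < m" for k m \<omega>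
    using monoD[OF R(1), of k m] that R(2)[of m] by (auto simp: Y_def)
  have BC: "AE \<omega> in M. eventually (\<lambda>k. \<omega> \<in> space M - E k) sequentially"
    by (rule borel_cantelli_AE1) (use XR in \<open>auto simp: E_def emeasure_eq_measure\<close>)
  have AE: "AE \<omega> in M. eventually (\<lambda>k. \<omega> \<in> space M - E k) sequentially \<and>
    (\<exists>N. \<forall>n m t. N \<le> n \<longrightarrow> n \<le> m \<longrightarrow> cmod (centred_sum M a Y n m t \<omega>)
      \<le> 20 * l2_tail a n * (sqrt (ln (R m * (real m + 2))) + sqrt (ln (\<bar>t\<bar> + 3))))"
    by (rule AE_conjI[OF BC AE_centred_sum_le[OF indY YR R(2) a]])
  define D where "D k = l2_tail a 0 * (2 * prob (E k))" for k
  have Dsum: "summable D"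
    unfolding D_def E_def by (intro summable_mult XR)
  have D: "cmod (a k * (char_fun M (X k) t - char_fun M (Y k) t)) \<le> D k" for k t
    unfolding D_def norm_mult
    by (intro mult_mono norm_le_l2_tail_0[OF a] char_fun_cong_le)
      (auto simp: Y_def E_def l2_tail_nonneg)
  show ?thesis
    using AE AE_space
  proof (eventually_elim, intro allI impI)
    case (elim \<omega>)
    fix K :: "real set" assume K: "compact K" "0 \<notin> K"
    note * = elim(1) and \<omega> = elim(2)
    obtain N1 where N1: "\<And>k. N1 \<le> k \<Longrightarrow> X k \<omega> = Y k \<omega>"
    proof -
      obtain N1 where "\<And>k. N1 \<le> k \<Longrightarrow> \<omega> \<notin> E k"
        using * unfolding eventually_sequentially by blast
      then show ?thesis using \<omega> by (intro that[of N1]) (auto simp: E_def Y_def not_less)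
    qed
    from * obtain N2 where N2: "\<And>n m t. N2 \<le> n \<Longrightarrow> n \<le> m \<Longrightarrow> cmod (centred_sum M a Y n m t \<omega>)
        \<le> 20 * l2_tail a n * (sqrt (ln (R m * (real m + 2))) + sqrt (ln (\<bar>t\<bar> + 3)))"
      by blast
    obtain A where A: "\<And>\<alpha>. \<alpha> \<in> K \<Longrightarrow> \<bar>\<alpha>\<bar> \<le> A" and A0: "0 \<le> A"
      using compact_imp_bounded[OF K(1)] unfolding bounded_pos real_norm_def by (auto intro: less_imp_le)
    define cA where "cA = sqrt (ln (A + 1)) + 1"
    have cA0: "0 \<le> cA" unfolding cA_def using A0 by simp
    define s where "s m = sqrt (ln (R m * (real m + 2)))" for m
    have s1: "1 \<le> s m" if "2 \<le> m" for m
    proof -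
      have "3 * 1 \<le> (real m + 2) * R m" using that R(2)[of m] by (intro mult_mono) auto
      then have "exp 1 \<le> R m * (real m + 2)" using exp_le by (simp add: mult.commute)
      moreover have "0 < R m * (real m + 2)" using R(2)[of m] by simp
      ultimately show ?thesis unfolding s_def by (simp add: ln_ge_iff)
    qed
    have smono: "s m \<le> s m'" if "m \<le> m'" for m m'
    proof -
      have "R m * (real m + 2) \<le> R m' * (real m' + 2)"
        using that monoD[OF R(1) that] R(2)[of m] by (intro mult_mono) auto
      moreover have "0 < R m * (real m + 2)" using R(2)[of m] by simp
      ultimately show ?thesis unfolding s_def by simp
    qed
    \<comment> \<open>The 20 comes from the almost sure bound. The factor \<open>1 + cA\<close>
      collects its two roots: the first is at most \<open>c * g (N (Suc i))\<close>, the second at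
      most \<open>cA\<close> times the weight in \<open>j\<close>.\<close>
    define b where "b i = 20 * (1 + cA) * c * (l2_tail a (N i) * g (N (Suc i)))" for i
    have bsum: "summable b" unfolding b_def by (intro summable_mult blocks)
    have N2': "2 \<le> N i" for i using N(2) strict_mono_less_eq[OF N(1), of 0 i] by simp
    \<comment> \<open>Being at least 1 lets this quantity multiply the frequency root, which turns
      the sum of the two roots into a single product.\<close>
    have cg1: "1 \<le> c * g (N i)" for i using s1[OF N2'] Rg[OF N2'] unfolding s_def by (rule order_trans)
    have b0: "0 \<le> b i" for i
    proof -
      have "0 \<le> c * g (N (Suc i))" using cg1[of "Suc i"] by linarith
      moreover have "0 \<le> 20 * (1 + cA) * l2_tail a (N i)" using cA0 l2_tail_nonneg[of a] by simp
      ultimately have "0 \<le> (20 * (1 + cA) * l2_tail a (N i)) * (c * g (N (Suc i)))"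
        by (rule mult_nonneg_nonneg[rotated])
      then show ?thesis unfolding b_def by (simp add: mult_ac)
    qed
    show "exp_sums_small a (\<lambda>k. X k \<omega>) K"
      unfolding exp_sums_small_def
    proof (intro allI impI)
      fix e :: real assume e: "0 < e"
      then have e3: "0 < e / 3" by simp
      obtain N3 where N3: "\<And>n m. N3 \<le> n \<Longrightarrow> norm (sum D {n..<m}) < e / 3"
        using Dsum e3 unfolding summable_Cauchy by blast
      obtain I where I: "\<And>n m. I \<le> n \<Longrightarrow> norm (sum b {n..<m}) < e / 3"
        using bsum e3 unfolding summable_Cauchy by blast
      obtain N4 where N4: "\<And>n m \<alpha> j. N4 \<le> n \<Longrightarrow> n \<le> m \<Longrightarrow> \<alpha> \<in> K \<Longrightarrow> j \<noteq> 0 \<Longrightarrow>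
          cmod (\<Sum>k=n..<m. a k * char_fun M (X k) (of_int j * \<alpha>)) \<le> e / 3"
        using char[OF K e3] by blast
      \<comment> \<open>A strictly increasing \<open>N\<close> satisfies \<open>N i \<ge> i\<close>,
        so from block \<open>i0\<close> on both the almost sure bound and the Cauchy estimate for
        \<open>b\<close> apply.\<close>
      define i0 where "i0 = max I N2"
      have i0: "N2 \<le> N i0" using seq_suble[OF N(1), of i0] unfolding i0_def by linarith
      show "\<exists>N. \<forall>n m \<alpha>. \<forall>j::int. N \<le> n \<longrightarrow> n \<le> m \<longrightarrow> \<alpha> \<in> K \<longrightarrow> j \<noteq> 0 \<longrightarrow>
        cmod (\<Sum>k=n..<m. a k * cis (2 * pi * (of_int j * \<alpha>) * X k \<omega>))
          \<le> e * sqrt (ln (real_of_int \<bar>j\<bar> + 3))"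
      proof (intro exI[of _ "max (N i0) (max N1 (max N3 N4))"] allI impI)
        fix n m \<alpha> and j :: int
        assume n: "max (N i0) (max N1 (max N3 N4)) \<le> n" and nm: "n \<le> m" and \<alpha>: "\<alpha> \<in> K" and j: "j \<noteq> 0"
        define t where "t = of_int j * \<alpha>"
        define \<rho> where "\<rho> = sqrt (ln (real_of_int \<bar>j\<bar> + 3))"
        have \<rho>1: "1 \<le> \<rho>" unfolding \<rho>_def using sqrt_ln_ge_1[of "of_int j"] by simp
        have t\<rho>: "sqrt (ln (\<bar>t\<bar> + 3)) \<le> cA * \<rho>"
          unfolding t_def cA_def \<rho>_def by (rule sqrt_ln_mult_le) (rule A[OF \<alpha>])
        define u where "u k = a k * (cis (2 * pi * t * Y k \<omega>) - char_fun M (Y k) t)" for k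
        define i1 where "i1 = max i0 m"
        have i1: "m \<le> N i1" "i0 \<le> i1"
          using seq_suble[OF N(1), of i1] unfolding i1_def by linarith+
        have "norm (sum u {n..<m}) \<le> sum (\<lambda>i. b i * \<rho>) {i0..<i1}"
        proof (rule norm_sum_blocks_le[OF strict_mono_mono[OF N(1)] _ _ i1(2) _ nm i1(1)])
          show "0 \<le> b i * \<rho>" for i using b0 \<rho>1 by simp
          show "N i0 \<le> n" using n by simp
          fix i n m assume i: "i0 \<le> i" "N i \<le> n" "n \<le> m" "m \<le> N (Suc i)"
          have "N i0 \<le> N i" using N(1) i(1) by (simp add: strict_mono_less_eq)
          then have "norm (sum u {n..<m}) \<le> 20 * l2_tail a n * (s m + sqrt (ln (\<bar>t\<bar> + 3)))"
            using N2[of n m t] i i0 unfolding u_def s_def centred_sum_def by simp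
          also have "\<dots> \<le> 20 * l2_tail a (N i) * ((1 + cA) * (c * g (N (Suc i))) * \<rho>)"
          proof (intro mult_mono mult_left_mono l2_tail_antimono a i)
            define x where "x = c * g (N (Suc i))"
            have x1: "1 \<le> x" unfolding x_def by (rule cg1)
            have "s m \<le> x" using smono[OF i(4)] Rg[OF N2', of "Suc i"] unfolding s_def x_def by linarith
            also have "x \<le> x * \<rho>" using x1 \<rho>1 by (simp add: mult_le_cancel_left1)
            finally have "s m \<le> x * \<rho>" .
            moreover have "cA * \<rho> * 1 \<le> cA * \<rho> * x"
              using x1 cA0 \<rho>1 by (intro mult_left_mono) auto
            ultimately show "s m + sqrt (ln (\<bar>t\<bar> + 3)) \<le> (1 + cA) * x * \<rho>"
              using t\<rho> by (simp add: algebra_simps)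
            have "1 * 1 \<le> R m * (real m + 2)" using R(2)[of m] by (intro mult_mono) auto
            then show "0 \<le> s m + sqrt (ln (\<bar>t\<bar> + 3))" unfolding s_def by simp
          qed (use l2_tail_nonneg in auto)
          also have "\<dots> = b i * \<rho>" unfolding b_def by simp
          finally show "norm (sum u {n..<m}) \<le> b i * \<rho>" .
        qed
        also have "\<dots> = sum b {i0..<i1} * \<rho>" by (simp add: sum_distrib_right)
        also have "\<dots> \<le> e / 3 * \<rho>"
          using I[of i0 i1] \<rho>1 by (intro mult_right_mono) (auto simp: i0_def)
        finally have u: "norm (sum u {n..<m}) \<le> e / 3 * \<rho>" .
        have v: "cmod (\<Sum>k=n..<m. a k * char_fun M (X k) t) \<le> e / 3 * \<rho>"
        proof -
          have "cmod (\<Sum>k=n..<m. a k * char_fun M (X k) t) \<le> e / 3 * 1"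
            using N4[of n m \<alpha> j] n nm \<alpha> j unfolding t_def by simp
          also have "\<dots> \<le> e / 3 * \<rho>" using e \<rho>1 by (intro mult_left_mono) auto
          finally show ?thesis .
        qed
        have w: "cmod (\<Sum>k=n..<m. a k * (char_fun M (X k) t - char_fun M (Y k) t)) \<le> e / 3 * \<rho>"
        proof -
          have "cmod (\<Sum>k=n..<m. a k * (char_fun M (X k) t - char_fun M (Y k) t)) \<le> sum D {n..<m}"
            by (rule order_trans[OF norm_sum sum_mono[OF D]])
          also have "\<dots> \<le> e / 3 * 1" using N3[of n m] n by simp
          also have "\<dots> \<le> e / 3 * \<rho>" using e \<rho>1 by (intro mult_left_mono) auto
          finally show ?thesis .
        qed
        have "(\<Sum>k=n..<m. a k * cis (2 * pi * t * X k \<omega>)) = (\<Sum>k=n..<m. a k * cis (2 * pi * t * Y k \<omega>))"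
          using N1 n by (intro sum.cong) auto
        also have "\<dots> = sum u {n..<m} + (\<Sum>k=n..<m. a k * char_fun M (X k) t)
            - (\<Sum>k=n..<m. a k * (char_fun M (X k) t - char_fun M (Y k) t))"
          unfolding u_def by (simp add: algebra_simps sum.distrib sum_subtractf)
        also have "cmod \<dots> \<le> (e / 3 * \<rho> + e / 3 * \<rho>) + e / 3 * \<rho>"
          by (intro order_trans[OF norm_triangle_ineq4] order_trans[OF norm_triangle_ineq] add_mono u v w)
        also have "\<dots> = e * \<rho>" by simp
        finally show "cmod (\<Sum>k=n..<m. a k * cis (2 * pi * (of_int j * \<alpha>) * X k \<omega>))
          \<le> e * sqrt (ln (real_of_int \<bar>j\<bar> + 3))"
          unfolding t_def \<rho>_def .
      qed
    qed
  qed
qed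

section \<open>Truncation levels from moment bounds\<close>

text \<open>Markov's inequality for the moment of order \<beta>, at a level chosen so that the bound
  is \<open>c / (k + 1)\<^sup>2\<close>. Using \<open>1 + h k\<close> keeps the level positive where
  \<open>h k\<close> vanishes.\<close>

lemma (in prob_space) summable_prob_truncation:
  assumes X: "\<And>k. X k \<in> borel_measurable M" and mom: "moments_bigo M X \<beta> h" and \<beta>: "0 < \<beta>" and h: "\<And>k. 0 \<le> h k"
  shows "summable (\<lambda>k. prob {\<omega>\<in>space M. ((real k + 1)\<^sup>2 * (1 + h k)) powr (1 / \<beta>) < \<bar>X k \<omega>\<bar>})"
proof -
  note X [measurable]
  obtain c where c: "0 < c" "eventually (\<lambda>k. norm (LINT \<omega>|M. \<bar>X k \<omega>\<bar> powr \<beta>) \<le> c * norm (h k)) sequentially"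
    using mom unfolding moments_bigo_def by (auto elim!: landau_o.bigE)
  have "eventually (\<lambda>k. norm (prob {\<omega>\<in>space M. ((real k + 1)\<^sup>2 * (1 + h k)) powr (1 / \<beta>) < \<bar>X k \<omega>\<bar>})
      \<le> c * (1 / (real k + 1)\<^sup>2)) sequentially"
    using c(2) mom[unfolded moments_bigo_def, THEN conjunct1]
  proof eventually_elim
    case (elim k)
    define r where "r = (real k + 1)\<^sup>2 * (1 + h k)"
    have r: "0 < r" unfolding r_def using h[of k] by simp
    have "{\<omega>\<in>space M. r powr (1 / \<beta>) < \<bar>X k \<omega>\<bar>} \<subseteq> {\<omega>\<in>space M. r \<le> \<bar>X k \<omega>\<bar> powr \<beta>}"
    proof safe
      fix \<omega> assume "r powr (1 / \<beta>) < \<bar>X k \<omega>\<bar>"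
      then have "(r powr (1 / \<beta>)) powr \<beta> \<le> \<bar>X k \<omega>\<bar> powr \<beta>" using \<beta> by (intro powr_mono2) auto
      then show "r \<le> \<bar>X k \<omega>\<bar> powr \<beta>" using \<beta> r by (simp add: powr_powr)
    qed
    then have "prob {\<omega>\<in>space M. r powr (1 / \<beta>) < \<bar>X k \<omega>\<bar>} \<le> prob {\<omega>\<in>space M. r \<le> \<bar>X k \<omega>\<bar> powr \<beta>}"
      by (rule finite_measure_mono) measurable
    also have "\<dots> \<le> (LINT \<omega>|M. \<bar>X k \<omega>\<bar> powr \<beta>) / r"
      by (rule integral_Markov_inequality_measure[where A = "{}"]) (use elim(2) r in auto)
    also have "\<dots> \<le> c * (1 + h k) / r"
    proof (rule divide_right_mono)
      have "(LINT \<omega>|M. \<bar>X k \<omega>\<bar> powr \<beta>) \<le> c * h k" using elim(1) h[of k] by simp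
      then show "(LINT \<omega>|M. \<bar>X k \<omega>\<bar> powr \<beta>) \<le> c * (1 + h k)" using c(1) by (simp add: algebra_simps)
    qed (use r in simp)
    also have "\<dots> = c * (1 / (real k + 1)\<^sup>2)" unfolding r_def using h[of k] by simp
    finally show ?case unfolding r_def by simp
  qed
  moreover have "summable (\<lambda>k. c * (1 / (real k + 1)\<^sup>2))"
    using summable_inverse_square_shift[of 1] by (intro summable_mult) simp
  ultimately show ?thesis by (rule summable_comparison_test_ev)
qed

text \<open>For \<open>m \<ge> 2\<close> one has \<open>m + 2 \<le> m\<^sup>2\<close>, so each
  polynomial factor costs at most \<open>2 * ln m\<close>: the squared one accounts for
  \<open>4 * c\<close>, the last one for \<open>2 * c\<close>, and the moment bound for
  \<open>d\<close>.\<close>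

lemma sqrt_ln_truncation_le:
  fixes h :: real
  assumes \<beta>: "0 < \<beta>" and m: "2 \<le> m" and h: "0 \<le> h"
    and c: "ln (real m) \<le> c * g\<^sup>2" "ln (1 + h) \<le> d * g\<^sup>2" and g: "0 \<le> g"
  shows "sqrt (ln (((real m + 1)\<^sup>2 * (1 + h)) powr (1 / \<beta>) * (real m + 2))) \<le> sqrt ((4 * c + d) / \<beta> + 2 * c) * g"
proof -
  have le: "real m + 2 \<le> (real m)\<^sup>2" using m
  proof -
    have m': "2 \<le> real m" using m by simp
    then have "2 * real m \<le> real m * real m" by (intro mult_right_mono) auto
    with m' show ?thesis unfolding power2_eq_square by linarith
  qed
  have l2: "ln (real m + 2) \<le> 2 * ln (real m)"
  proof -
    have "ln (real m + 2) \<le> ln ((real m)\<^sup>2)" using le by (intro ln_mono) auto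
    then show ?thesis using m by (simp add: ln_realpow)
  qed
  have "ln (real m + 1) \<le> ln (real m + 2)" by simp
  with l2 c(1) have l1: "ln (real m + 1) \<le> 2 * (c * g\<^sup>2)" by linarith
  have "ln (((real m + 1)\<^sup>2 * (1 + h)) powr (1 / \<beta>) * (real m + 2))
      = (2 * ln (real m + 1) + ln (1 + h)) / \<beta> + ln (real m + 2)"
    using h by (simp add: ln_mult_pos ln_powr ln_realpow)
  also have "\<dots> \<le> (2 * (2 * (c * g\<^sup>2)) + d * g\<^sup>2) / \<beta> + 2 * (c * g\<^sup>2)"
    using l1 l2 c \<beta> by (intro add_mono divide_right_mono) auto
  also have "\<dots> = ((4 * c + d) / \<beta> + 2 * c) * g\<^sup>2" by (simp add: algebra_simps add_divide_distrib)
  finally have "sqrt (ln (((real m + 1)\<^sup>2 * (1 + h)) powr (1 / \<beta>) * (real m + 2)))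
      \<le> sqrt (((4 * c + d) / \<beta> + 2 * c) * g\<^sup>2)" by simp
  then show ?thesis using g by (simp add: real_sqrt_mult)
qed

lemma summable_on_atLeast_imp_summable:
  fixes f :: "nat \<Rightarrow> real"
  assumes "f summable_on {k..}"
  shows "summable f"
proof -
  have "f summable_on ({..<k} \<union> {k..})"
    by (rule summable_on_Un_disjoint) (use assms in auto)
  moreover have "{..<k} \<union> {k..} = UNIV" by auto
  ultimately show ?thesis by (intro summable_on_imp_summable) simp
qed

text \<open>Common form of the two cases. Here \<open>g\<close> measures the square root of the
  logarithm of the truncation level, \<open>w\<close> is the weight in the hypothesis on
  \<open>a\<close> and dominates the increments of \<open>g\<close>, and \<open>N\<close> lists
  places where \<open>g\<close> is geometric.\<close>

lemma (in prob_space) AE_exp_sums_small_moments: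
  fixes X :: "nat \<Rightarrow> 'a \<Rightarrow> real" and g h w :: "nat \<Rightarrow> real"
  assumes ind: "indep_vars (\<lambda>_. borel) X UNIV"
    and a: "(\<lambda>k. (cmod (a k))\<^sup>2) summable_on UNIV"
    and mom: "moments_bigo M X \<beta> h" "0 < \<beta>" "\<And>k. 0 \<le> h k" "mono h"
    and g: "mono_on {2..} g" "\<And>m. 0 \<le> g m"
    and c: "\<And>m. 2 \<le> m \<Longrightarrow> ln (real m) \<le> c * (g m)\<^sup>2" "\<And>m. 2 \<le> m \<Longrightarrow> ln (1 + h m) \<le> d * (g m)\<^sup>2"
    and w: "(\<lambda>n. l2_tail a n * w n) summable_on {n1..}" "\<And>n. 2 \<le> n \<Longrightarrow> g (Suc n) - g n \<le> w n"
    and N: "strict_mono N" "2 \<le> N 0" "\<And>i. g (N i) = b * r ^ i" "1 < r" "0 \<le> b"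
    and char: "\<And>K e. compact K \<Longrightarrow> 0 \<notin> K \<Longrightarrow> 0 < e \<Longrightarrow> \<exists>N. \<forall>n m \<alpha>. \<forall>j::int. N \<le> n \<longrightarrow> n \<le> m \<longrightarrow> \<alpha> \<in> K \<longrightarrow> j \<noteq> 0 \<longrightarrow>
      cmod (\<Sum>k=n..<m. a k * char_fun M (X k) (of_int j * \<alpha>)) \<le> e"
  shows "AE \<omega> in M. \<forall>K. compact K \<longrightarrow> 0 \<notin> K \<longrightarrow> exp_sums_small a (\<lambda>k. X k \<omega>) K"
proof (rule AE_exp_sums_small[OF ind a])
  define R where "R k = ((real k + 1)\<^sup>2 * (1 + h k)) powr (1 / \<beta>)" for k
  have X: "X k \<in> borel_measurable M" for k
    using ind unfolding indep_vars_def by blast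
  show "mono R"
    unfolding R_def using mom
    by (intro monoI powr_mono2 mult_mono power_mono add_mono) (auto dest: monoD)
  show "1 \<le> R k" for k
  proof -
    have "1 * 1 \<le> (real k + 1)\<^sup>2 * (1 + h k)"
      using mom(3)[of k] by (intro mult_mono) (auto intro: one_le_power)
    then show ?thesis unfolding R_def using mom(2) by (intro ge_one_powr_ge_zero) auto
  qed
  show "summable (\<lambda>k. prob {\<omega>\<in>space M. R k < \<bar>X k \<omega>\<bar>})"
    unfolding R_def by (intro summable_prob_truncation X mom)
  show "sqrt (ln (R m * (real m + 2))) \<le> sqrt ((4 * c + d) / \<beta> + 2 * c) * g m" if "2 \<le> m" for m
    unfolding R_def by (intro sqrt_ln_truncation_le mom that c g)
  show "strict_mono N" "2 \<le> N 0" by fact+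
  have "summable (\<lambda>n. l2_tail a n * (g (Suc n) - g n))"
  proof (rule summable_comparison_test'[OF summable_on_atLeast_imp_summable[OF w(1)]])
    fix n :: nat assume n: "2 \<le> n"
    then have "0 \<le> g (Suc n) - g n" using mono_onD[OF g(1), of n "Suc n"] by simp
    then show "norm (l2_tail a n * (g (Suc n) - g n)) \<le> l2_tail a n * w n"
      using w(2)[OF n] l2_tail_nonneg[of a n] by (simp add: abs_mult mult_left_mono)
  qed
  moreover have "antimono (l2_tail a)" by (intro antimonoI l2_tail_antimono a)
  ultimately show "summable (\<lambda>i. l2_tail a (N i) * g (N (Suc i)))"
    by (intro summable_blocks[OF _ l2_tail_nonneg g(1) _ N(1,3,4,2,5)]) 
qed (rule char)

section \<open>Unfolding the hypotheses and the two cases\<close>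

lemma char_sums_small:
  fixes F :: "nat \<Rightarrow> real \<Rightarrow> complex"
  assumes S: "\<forall>\<epsilon>>0. \<exists>N>0.
             (SUP (n, m) \<in> {(n, m). N \<le> n \<and> n < m}. SUP \<alpha> \<in> K. SUP j \<in> UNIV - {0 :: int}.
                ereal (cmod (\<Sum>k=n..m. a k * F k (of_int j * \<alpha>)))) < ereal \<epsilon>"
    and e: "0 < e"
  shows "\<exists>N. \<forall>n m \<alpha>. \<forall>j::int. N \<le> n \<longrightarrow> n \<le> m \<longrightarrow> \<alpha> \<in> K \<longrightarrow> j \<noteq> 0 \<longrightarrow>
      cmod (\<Sum>k=n..<m. a k * F k (of_int j * \<alpha>)) \<le> e"
proof -
  have "0 < e / 2" using e by simp
  with S obtain N :: nat where N: "(SUP (n, m) \<in> {(n, m). N \<le> n \<and> n < m}. SUP \<alpha> \<in> K. SUP j \<in> UNIV - {0 :: int}.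
                ereal (cmod (\<Sum>k=n..m. a k * F k (of_int j * \<alpha>)))) < ereal (e / 2)"
    by blast
  have le: "cmod (\<Sum>k=n..m. a k * F k (of_int j * \<alpha>)) \<le> e / 2"
    if "N \<le> n" "n < m" "\<alpha> \<in> K" "j \<noteq> 0" for n m \<alpha> and j :: int
  proof -
    have "ereal (cmod (\<Sum>k=n..m. a k * F k (of_int j * \<alpha>)))
        \<le> (SUP j \<in> UNIV - {0 :: int}. ereal (cmod (\<Sum>k=n..m. a k * F k (of_int j * \<alpha>))))"
      by (rule SUP_upper) (use that in auto)
    also have "\<dots> \<le> (SUP \<alpha> \<in> K. SUP j \<in> UNIV - {0 :: int}. ereal (cmod (\<Sum>k=n..m. a k * F k (of_int j * \<alpha>))))"
      by (rule SUP_upper) (use that in auto)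
    also have "\<dots> \<le> (SUP (n, m) \<in> {(n, m). N \<le> n \<and> n < m}. SUP \<alpha> \<in> K. SUP j \<in> UNIV - {0 :: int}.
                ereal (cmod (\<Sum>k=n..m. a k * F k (of_int j * \<alpha>))))"
      by (rule SUP_upper2[of "(n, m)"]) (use that in auto)
    also note N
    finally show ?thesis by simp
  qed
  show ?thesis
  proof (intro exI[of _ N] allI impI)
    fix n m \<alpha> and j :: int assume *: "N \<le> n" "n \<le> m" "\<alpha> \<in> K" "j \<noteq> 0"
    let ?u = "\<lambda>k. a k * F k (of_int j * \<alpha>)"
    show "cmod (\<Sum>k=n..<m. ?u k) \<le> e"
    proof (cases "n = m")
      case True
      then show ?thesis using e by simp
    next
      case False
      \<comment> \<open>The hypothesis covers closed ranges with at least two terms, while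
        \<open>{n..<m}\<close> may have a single one. It is therefore a difference of two admissible
        ranges ending at \<open>Suc m\<close>, each bounded by \<open>e / 2\<close>.\<close>
      have "sum ?u {n..<m} + sum ?u {m..<Suc (Suc m)} = sum ?u {n..<Suc (Suc m)}"
        using * by (intro sum.atLeastLessThan_concat) auto
      then have "sum ?u {n..<m} = sum ?u {n..Suc m} - sum ?u {m..Suc m}"
        by (simp only: atLeastLessThanSuc_atLeastAtMost) (simp add: algebra_simps)
      also have "cmod \<dots> \<le> e / 2 + e / 2"
        using * False by (intro order_trans[OF norm_triangle_ineq4] add_mono le) auto
      finally show ?thesis by simp
    qed
  qed
qed

theorem theorem1p1:
  fixes M :: "'a measure"
    and X :: "nat \<Rightarrow> 'a \<Rightarrow> real"
    and a :: "nat \<Rightarrow> complex"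
  assumes "prob_space M"
    and "prob_space.indep_vars M (\<lambda>_. borel) X UNIV"
    and "\<And>K :: real set. compact K \<Longrightarrow> 0 \<notin> K \<Longrightarrow>
           \<forall>\<epsilon>>0. \<exists>N>0.
             (SUP (n, m) \<in> {(n, m). N \<le> n \<and> n < m}. SUP \<alpha> \<in> K. SUP j \<in> UNIV - {0 :: int}.
                ereal (cmod (\<Sum>k=n..m. a k * char_fun M (X k) (of_int j * \<alpha>)))) < ereal \<epsilon>"
    and "(\<exists>\<beta>>0. \<exists>d>0. moments_bigo M X \<beta> (\<lambda>k. real k powr d) \<and>
            (\<lambda>k. (cmod (a k))\<^sup>2) summable_on UNIV \<and>
            (\<lambda>n. sqrt (\<Sum>\<^sub>\<infinity>k\<in>{n..}. (cmod (a k))\<^sup>2) / (real n * sqrt (ln (real n))))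
              summable_on {2..})
       \<or> (\<exists>\<beta>>0. \<exists>\<gamma>\<in>{0<..<1}. moments_bigo M X \<beta> (\<lambda>k. 2 powr (real k powr \<gamma>)) \<and>
            (\<lambda>k. (cmod (a k))\<^sup>2) summable_on UNIV \<and>
            (\<lambda>n. sqrt (\<Sum>\<^sub>\<infinity>k\<in>{n..}. (cmod (a k))\<^sup>2) / real n powr (1 - \<gamma> / 2))
              summable_on {1..})"
  shows "\<exists>\<Omega>\<^sub>0 \<in> sets M. measure M \<Omega>\<^sub>0 = 1 \<and>
           (\<forall>\<omega>\<in>\<Omega>\<^sub>0. \<forall>f\<in>B_torus. (LINT t:{0..1}|lborel. f t) = 0 \<longrightarrow>
              (\<forall>\<alpha>. \<alpha> \<noteq> 0 \<longrightarrow> summable (\<lambda>k. a k * f (\<alpha> * X k \<omega>))) \<and>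
              continuous_on (UNIV - {0}) (\<lambda>\<alpha>. \<Sum>k. a k * f (\<alpha> * X k \<omega>)) \<and>
              (\<forall>K. compact K \<and> 0 \<notin> K \<longrightarrow>
                 uniform_limit K (\<lambda>n \<alpha>. \<Sum>k<n. a k * f (\<alpha> * X k \<omega>))
                   (\<lambda>\<alpha>. \<Sum>k. a k * f (\<alpha> * X k \<omega>)) sequentially))"
proof -
  interpret prob_space M by fact
  note ind = assms(2)
  note char = char_sums_small[OF assms(3)]
  have AE: "AE \<omega> in M. \<forall>K. compact K \<longrightarrow> 0 \<notin> K \<longrightarrow> exp_sums_small a (\<lambda>k. X k \<omega>) K"
    using assms(4)
  proof (elim disjE exE conjE bexE)
    fix \<beta> d :: real
    assume \<beta>: "0 < \<beta>" and d: "0 < d" and mom: "moments_bigo M X \<beta> (\<lambda>k. real k powr d)"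
      and a: "(\<lambda>k. (cmod (a k))\<^sup>2) summable_on UNIV"
      and w: "(\<lambda>n. sqrt (\<Sum>\<^sub>\<infinity>k\<in>{n..}. (cmod (a k))\<^sup>2) / (real n * sqrt (ln (real n)))) summable_on {2..}"
    \<comment> \<open>Both weights are discrete derivatives of some \<open>g\<close> that is geometric along suitable blocks:
      here \<open>g = sqrt \<circ> ln\<close> with blocks \<open>2 ^ 2 ^ i\<close>, in the other case \<open>g n = n powr (\<gamma> / 2)\<close> with dyadic blocks.\<close>
    define g where "g n = sqrt (ln (real n))" for n
    have g2: "(g m)\<^sup>2 = ln (real m)" if "2 \<le> m" for m
      using that unfolding g_def by simp
    show ?thesis
    proof (rule AE_exp_sums_small_moments[OF ind a mom \<beta>])
      show "mono (\<lambda>k. real k powr d)" using d by (intro monoI powr_mono2) auto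
      show "mono_on {2..} g" unfolding g_def by (intro mono_onI) simp
      show "0 \<le> g m" for m unfolding g_def by (cases m) auto
      show "ln (real m) \<le> 1 * (g m)\<^sup>2" if "2 \<le> m" for m using g2[OF that] by simp
      show "ln (1 + real m powr d) \<le> (1 + d) * (g m)\<^sup>2" if m: "2 \<le> m" for m
      proof -
        have "1 \<le> real m powr d" using m d by (intro ge_one_powr_ge_zero) auto
        then have "1 + real m powr d \<le> real m * real m powr d"
          using m mult_right_mono[of 2 "real m" "real m powr d"] by linarith
        then have "ln (1 + real m powr d) \<le> ln (real m * real m powr d)"
          by (intro ln_mono) (auto intro: add_pos_nonneg)
        also have "\<dots> = (1 + d) * ln (real m)"
          using m by (simp add: ln_mult_pos ln_powr algebra_simps)
        finally show ?thesis using g2[OF m] by simp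
      qed
      show "(\<lambda>n. l2_tail a n * (1 / (real n * sqrt (ln (real n))))) summable_on {2..}"
        using w unfolding l2_tail_def by simp
      show "g (Suc n) - g n \<le> 1 / (real n * sqrt (ln (real n)))" if n: "2 \<le> n" for n
      proof -
        have g0: "0 < g n" unfolding g_def using n by simp
        have le: "g n \<le> g (Suc n)" unfolding g_def using n by simp
        \<comment> \<open>The difference of the squares is \<open>ln (1 + 1 / n)\<close>, at most
          \<open>1 / n\<close>; dropping \<open>g (Suc n)\<close> from the second factor leaves
          division by \<open>g n\<close>.\<close>
        have "(g (Suc n) - g n) * g n \<le> (g (Suc n) - g n) * (g (Suc n) + g n)"
          using g0 le by (intro mult_left_mono) auto
        also have "\<dots> = (g (Suc n))\<^sup>2 - (g n)\<^sup>2" by (simp add: power2_eq_square algebra_simps)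
        also have "\<dots> = ln (real (Suc n) / real n)" using n g2[of n] g2[of "Suc n"] by (simp add: ln_div)
        also have "\<dots> \<le> real (Suc n) / real n - 1" using n by (intro ln_le_minus_one) simp
        also have "\<dots> = 1 / real n" using n by (simp add: field_simps)
        finally have "g (Suc n) - g n \<le> 1 / real n / g n" using g0 by (simp only: pos_le_divide_eq)
        then show ?thesis unfolding g_def by simp
      qed
      show "strict_mono (\<lambda>i::nat. 2 ^ 2 ^ i :: nat)" by (intro strict_monoI power_strict_increasing) auto
      show "g (2 ^ 2 ^ i) = sqrt (ln 2) * sqrt 2 ^ i" for i
        unfolding g_def by (simp add: ln_realpow real_sqrt_mult real_sqrt_power)
    qed (use d char in auto)
  next
    fix \<beta> \<gamma> :: real
    assume \<beta>: "0 < \<beta>" and \<gamma>': "\<gamma> \<in> {0<..<1}" and mom: "moments_bigo M X \<beta> (\<lambda>k. 2 powr (real k powr \<gamma>))"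
      and a: "(\<lambda>k. (cmod (a k))\<^sup>2) summable_on UNIV"
      and w: "(\<lambda>n. sqrt (\<Sum>\<^sub>\<infinity>k\<in>{n..}. (cmod (a k))\<^sup>2) / real n powr (1 - \<gamma> / 2)) summable_on {1..}"
    define g where "g n = real n powr (\<gamma> / 2)" for n
    have \<gamma>: "0 < \<gamma>" "\<gamma> < 1" using \<gamma>' by auto
    have g2: "(g m)\<^sup>2 = real m powr \<gamma>" for m
      unfolding g_def by (simp add: power2_eq_square flip: powr_add)
    show ?thesis
    proof (rule AE_exp_sums_small_moments[OF ind a mom \<beta>])
      show "mono (\<lambda>k. 2 powr (real k powr \<gamma>))" using \<gamma> by (intro monoI powr_mono powr_mono2) auto
      show "mono_on {2..} g" unfolding g_def using \<gamma> by (intro mono_onI powr_mono2) auto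
      show "0 \<le> g m" for m unfolding g_def by simp
      show "ln (real m) \<le> (1 / \<gamma>) * (g m)\<^sup>2" if m: "2 \<le> m" for m
      proof -
        have "\<gamma> * ln (real m) = ln (real m powr \<gamma>)" using m by (simp add: ln_powr)
        also have "\<dots> \<le> real m powr \<gamma> - 1" using m by (intro ln_le_minus_one) simp
        finally show ?thesis using \<gamma> unfolding g2 by (simp add: field_simps)
      qed
      show "ln (1 + 2 powr (real m powr \<gamma>)) \<le> 2 * (g m)\<^sup>2" if m: "2 \<le> m" for m
      proof -
        have p1: "1 \<le> real m powr \<gamma>" using m \<gamma> by (intro ge_one_powr_ge_zero) auto
        have "(1::real) \<le> 2 powr (real m powr \<gamma>)" by (intro ge_one_powr_ge_zero) auto
        then have "ln (1 + 2 powr (real m powr \<gamma>)) \<le> ln (2 * 2 powr (real m powr \<gamma>))"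
          by (intro ln_mono) auto
        also have "\<dots> = (1 + real m powr \<gamma>) * ln 2" by (simp add: ln_mult_pos ln_powr algebra_simps)
        also have "\<dots> \<le> (1 + real m powr \<gamma>) * 1" using ln_2_less_1 by (intro mult_left_mono) auto
        finally show ?thesis using p1 unfolding g2 by simp
      qed
      show "(\<lambda>n. l2_tail a n * (1 / real n powr (1 - \<gamma> / 2))) summable_on {1..}"
        using w unfolding l2_tail_def by simp
      show "g (Suc n) - g n \<le> 1 / real n powr (1 - \<gamma> / 2)" if n: "2 \<le> n" for n
      proof -
        have "real (Suc n) = real n * (1 + 1 / real n)" using n by (simp add: field_simps)
        then have "g (Suc n) = g n * (1 + 1 / real n) powr (\<gamma> / 2)"
          unfolding g_def using n by (simp only: powr_mult)
        \<comment> \<open>The base is at least 1, so the exponent may be raised from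
          \<open>\<gamma> / 2\<close> to 1, which makes the increment explicit.\<close>
        also have "\<dots> \<le> g n * (1 + 1 / real n) powr 1"
          using \<gamma> by (intro mult_left_mono powr_mono) (auto simp: g_def)
        also have "\<dots> = g n + real n powr (\<gamma> / 2) / real n powr 1"
          using n by (simp add: g_def algebra_simps)
        also have "\<dots> = g n + real n powr (- (1 - \<gamma> / 2))"
          unfolding powr_diff[symmetric] by simp
        also have "\<dots> = g n + 1 / real n powr (1 - \<gamma> / 2)"
          by (subst powr_minus_divide) simp
        finally show ?thesis by simp
      qed
      \<comment> \<open>Exponents starting at 1 put the first block at 2, as required; this shift is
        the constant in front of the geometric sequence below.\<close>
      show "strict_mono (\<lambda>i::nat. 2 ^ Suc i :: nat)" by (intro strict_monoI power_strict_increasing) auto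
      show "g (2 ^ Suc i) = 2 powr (\<gamma> / 2) * (2 powr (\<gamma> / 2)) ^ i" for i
        unfolding g_def by (simp add: powr_mult powr_power flip: powr_realpow powr_powr)
          (simp add: powr_powr mult.commute)
      show "1 < 2 powr (\<gamma> / 2)" using \<gamma> by (intro gr_one_powr) auto
    qed (use char in auto)
  qed
  \<comment> \<open>The bad outcomes involve uncountably many sets \<open>K\<close> and are not
    shown to form a measurable set; a measurable null set covering them is removed instead.\<close>
  then obtain S where S: "{\<omega>\<in>space M. \<not> (\<forall>K. compact K \<longrightarrow> 0 \<notin> K \<longrightarrow> exp_sums_small a (\<lambda>k. X k \<omega>) K)} \<subseteq> S"
      "emeasure M S = 0" "S \<in> sets M"
    by (rule AE_E)
  show ?thesis
  proof (intro bexI[of _ "space M - S"] conjI)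
    show "measure M (space M - S) = 1"
      using S prob_compl[of S] by (simp add: measure_def[of M S])
    show "space M - S \<in> sets M" using S by simp
  qed (intro ballI impI exp_sums_small_conclusion; use S(1) in blast)
qed

end
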